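(* Let $F$ be a field and let $n$ be an integer larger than two. Suppose that, in every finite extension of $F$, each element has a non-power balanced decomposition into a product of $n$ elements. Then, in every nonzero finite-dimensional associative unital algebra over $F$, each element has a non-power balanced decomposition into a product of $n$ elements of this algebra.
   Context: A factorisation $a=a_1a_2\cdots a_n$ of an element $a$ of a (not necessarily commutative) ring, with all $a_i$ in the ring, is called balanced if $a_1+\dots+a_n=0$. A factorisation is called a power factorisation if all its factors are equal, and non-power if at least two of its factors are not equal. Finite extensions of $F$ include $F$ itself. Algebras are not assumed to be commutative. *)

theory Defs
  imports "HOL-Algebra.Algebra"
begin

text \<open>
  HOL-Algebra's \<open>algebra\<close> locale requires a commutative algebra; here commutativity is dropped,
  so compatibility of scalars with multiplication is needed on both sides.
  The zero algebra is allowed.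
\<close>

locale unital_assoc_algebra = F: field F + module F A + A: ring A
  for F (structure) and A (structure) +
  assumes smult_mult_left:
      "\<lbrakk>c \<in> carrier F; x \<in> carrier A; y \<in> carrier A\<rbrakk> \<Longrightarrow>
       (c \<odot>\<^bsub>A\<^esub> x) \<otimes>\<^bsub>A\<^esub> y = c \<odot>\<^bsub>A\<^esub> (x \<otimes>\<^bsub>A\<^esub> y)"
    and smult_mult_right:
      "\<lbrakk>c \<in> carrier F; x \<in> carrier A; y \<in> carrier A\<rbrakk> \<Longrightarrow>
       x \<otimes>\<^bsub>A\<^esub> (c \<odot>\<^bsub>A\<^esub> y) = c \<odot>\<^bsub>A\<^esub> (x \<otimes>\<^bsub>A\<^esub> y)"

definition finitely_spanned :: "('a, 'm) ring_scheme \<Rightarrow> ('a, 'b, 'n) module_scheme \<Rightarrow> bool" where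
  "finitely_spanned F M \<longleftrightarrow>
     (\<exists>B. finite B \<and> B \<subseteq> carrier M \<and>
       (\<forall>x \<in> carrier M. \<exists>c \<in> B \<rightarrow> carrier F. x = (\<Oplus>\<^bsub>M\<^esub>b\<in>B. c b \<odot>\<^bsub>M\<^esub> b)))"

definition fin_dim_algebra :: "('a, 'm) ring_scheme \<Rightarrow> ('a, 'b, 'n) module_scheme \<Rightarrow> bool" where
  "fin_dim_algebra F A \<longleftrightarrow> unital_assoc_algebra F A \<and> finitely_spanned F A"

text \<open>The embedding of \<open>F\<close> into \<open>K\<close> is \<open>\<lambda>c. c \<odot>\<^bsub>K\<^esub> \<one>\<^bsub>K\<^esub>\<close>.\<close>

definition finite_field_ext :: "('a, 'm) ring_scheme \<Rightarrow> ('a, 'b, 'n) module_scheme \<Rightarrow> bool" where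
  "finite_field_ext F K \<longleftrightarrow> fin_dim_algebra F K \<and> field K"

definition balanced_factorisation :: "('b, 'm) ring_scheme \<Rightarrow> 'b list \<Rightarrow> 'b \<Rightarrow> bool" where
  "balanced_factorisation R xs a \<longleftrightarrow>
     set xs \<subseteq> carrier R \<and>
     foldr (\<otimes>\<^bsub>R\<^esub>) xs \<one>\<^bsub>R\<^esub> = a \<and>
     foldr (\<oplus>\<^bsub>R\<^esub>) xs \<zero>\<^bsub>R\<^esub> = \<zero>\<^bsub>R\<^esub>"

definition non_power :: "'b list \<Rightarrow> bool" where
  "non_power xs \<longleftrightarrow> (\<exists>x \<in> set xs. \<exists>y \<in> set xs. x \<noteq> y)"

definition has_non_power_balanced_factorisation ::
    "('b, 'm) ring_scheme \<Rightarrow> nat \<Rightarrow> 'b \<Rightarrow> bool" where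
  "has_non_power_balanced_factorisation R n a \<longleftrightarrow>
     (\<exists>xs. length xs = n \<and> balanced_factorisation R xs a \<and> non_power xs)"


text \<open>
  A quantifier inside a formula cannot range over types. The next lemma shows that every finite
  extension of a field with elements in \<open>'a\<close>, whatever the type of its own elements,
  has an isomorphic copy with elements in \<open>'a list\<close>, so that quantifying
  over \<open>('a, 'a list) module\<close> covers all finite extensions.
\<close>

lemma finite_field_ext_copy:
  fixes F :: "('a, 'm) ring_scheme" and K :: "('a, 'b, 'n) module_scheme"
  assumes "finite_field_ext F K"
  shows "\<exists>(L :: ('a, 'a list) module) h. finite_field_ext F L \<and> h \<in> ring_iso K L \<and>
           (\<forall>c \<in> carrier F. \<forall>x \<in> carrier K. h (c \<odot>\<^bsub>K\<^esub> x) = c \<odot>\<^bsub>L\<^esub> h x)"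
proof -
  have alg: "unital_assoc_algebra F K" and sp: "finitely_spanned F K" and fK: "field K"
    using assms by (auto simp: finite_field_ext_def fin_dim_algebra_def)
  interpret alg: unital_assoc_algebra F K by (rule alg)
  interpret K: field K by (rule fK)
  obtain B where B: "finite B" "B \<subseteq> carrier K"
    and span: "\<And>x. x \<in> carrier K \<Longrightarrow> \<exists>c \<in> B \<rightarrow> carrier F. x = (\<Oplus>\<^bsub>K\<^esub>b\<in>B. c b \<odot>\<^bsub>K\<^esub> b)"
    using sp unfolding finitely_spanned_def by blast
  obtain co where co: "\<And>x. x \<in> carrier K \<Longrightarrow> co x \<in> B \<rightarrow> carrier F"
      "\<And>x. x \<in> carrier K \<Longrightarrow> x = (\<Oplus>\<^bsub>K\<^esub>b\<in>B. co x b \<odot>\<^bsub>K\<^esub> b)"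
    using span by metis
  obtain bs where bs: "set bs = B" using finite_list[OF B(1)] by blast
  define h where "h x = map (co x) bs" for x
  have inj: "inj_on h (carrier K)"
  proof (rule inj_onI)
    fix x y assume xy: "x \<in> carrier K" "y \<in> carrier K" "h x = h y"
    have e: "co x b = co y b" if "b \<in> B" for b
      using xy(3) that bs by (simp add: h_def)
    have "(\<Oplus>\<^bsub>K\<^esub>b\<in>B. co x b \<odot>\<^bsub>K\<^esub> b) = (\<Oplus>\<^bsub>K\<^esub>b\<in>B. co y b \<odot>\<^bsub>K\<^esub> b)"
      using B co(1)[OF xy(2)] by (intro alg.finsum_cong') (auto simp: e intro!: alg.smult_closed)
    with co(2)[OF xy(1)] co(2)[OF xy(2)] show "x = y" by metis
  qed
  define g where "g = inv_into (carrier K) h"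
  have gh [simp]: "g (h x) = x" if "x \<in> carrier K" for x
    using that inj by (simp add: g_def)
  define L :: "('a, 'a list) module" where
    "L = \<lparr>carrier = h ` carrier K, monoid.mult = \<lambda>u v. h (g u \<otimes>\<^bsub>K\<^esub> g v), one = h \<one>\<^bsub>K\<^esub>,
          ring.zero = h \<zero>\<^bsub>K\<^esub>, ring.add = \<lambda>u v. h (g u \<oplus>\<^bsub>K\<^esub> g v), module.smult = \<lambda>c u. h (c \<odot>\<^bsub>K\<^esub> g u)\<rparr>"
  have Ls: "carrier L = h ` carrier K" "\<one>\<^bsub>L\<^esub> = h \<one>\<^bsub>K\<^esub>" "\<zero>\<^bsub>L\<^esub> = h \<zero>\<^bsub>K\<^esub>"
    "\<And>u v. u \<otimes>\<^bsub>L\<^esub> v = h (g u \<otimes>\<^bsub>K\<^esub> g v)" "\<And>u v. u \<oplus>\<^bsub>L\<^esub> v = h (g u \<oplus>\<^bsub>K\<^esub> g v)"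
    "\<And>c u. c \<odot>\<^bsub>L\<^esub> u = h (c \<odot>\<^bsub>K\<^esub> g u)"
    by (simp_all add: L_def)
  have cL: "cring L"
  proof (intro cringI abelian_groupI comm_monoidI)
    fix u assume "u \<in> carrier L"
    then obtain x where "x \<in> carrier K" "u = h x" by (auto simp: Ls)
    then show "\<exists>y\<in>carrier L. y \<oplus>\<^bsub>L\<^esub> u = \<zero>\<^bsub>L\<^esub>"
      by (auto simp: Ls alg.M.l_neg intro!: bexI[of _ "\<ominus>\<^bsub>K\<^esub> x"])
  qed (auto simp: Ls alg.A.m_assoc alg.M.a_assoc K.m_comm alg.M.a_comm K.m_lcomm alg.M.a_lcomm
      alg.A.l_distr alg.A.r_distr)
  interpret L: cring L by (rule cL)
  have fL: "field L"
  proof (rule L.cring_fieldI2)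
    show "\<zero>\<^bsub>L\<^esub> \<noteq> \<one>\<^bsub>L\<^esub>"
      using inj by (auto simp: Ls dest: inj_onD)
    fix u assume u: "u \<in> carrier L" "u \<noteq> \<zero>\<^bsub>L\<^esub>"
    then obtain x where x: "x \<in> carrier K" "u = h x" "x \<noteq> \<zero>\<^bsub>K\<^esub>" by (auto simp: Ls)
    then have "x \<in> Units K" using K.field_Units by auto
    then show "\<exists>v\<in>carrier L. u \<otimes>\<^bsub>L\<^esub> v = \<one>\<^bsub>L\<^esub>"
      using x by (auto simp: Ls intro!: bexI[of _ "inv\<^bsub>K\<^esub> x"])
  qed
  have h: "h \<in> ring_iso K L"
    by (auto simp: ring_iso_def ring_hom_def Ls bij_betw_def inj)
  have hs: "h (c \<odot>\<^bsub>K\<^esub> x) = c \<odot>\<^bsub>L\<^esub> h x" if "c \<in> carrier F" "x \<in> carrier K" for c x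
    using that by (simp add: Ls)
  have mL: "module F L"
    by (rule moduleI[OF alg.F.is_cring L.is_abelian_group])
      (auto simp: Ls alg.smult_l_distr alg.smult_r_distr alg.smult_assoc1)
  have aL: "unital_assoc_algebra F L"
    by (intro unital_assoc_algebra.intro unital_assoc_algebra_axioms.intro alg.F.field_axioms mL
        L.ring_axioms) (auto simp: Ls alg.smult_mult_left alg.smult_mult_right)
  interpret hom: ring_hom_cring K L h
    using h by (intro ring_hom_cring.intro ring_hom_cring_axioms.intro K.is_cring cL) (simp add: ring_iso_def)
  have "finitely_spanned F L"
    unfolding finitely_spanned_def
  proof (intro exI[of _ "h ` B"] conjI ballI)
    show "finite (h ` B)" "h ` B \<subseteq> carrier L" using B by (auto simp: Ls)
    fix u assume "u \<in> carrier L"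
    then obtain x where x: "x \<in> carrier K" "u = h x" by (auto simp: Ls)
    have cl: "(\<lambda>b. co x b \<odot>\<^bsub>K\<^esub> b) \<in> B \<rightarrow> carrier K"
      using B co(1)[OF x(1)] by (auto intro!: alg.smult_closed)
    have injB: "inj_on h B" using inj B(2) by (rule inj_on_subset)
    have ghB: "g (h b) = b" if "b \<in> B" for b using that B(2) by auto
    have "u = h (\<Oplus>\<^bsub>K\<^esub>b\<in>B. co x b \<odot>\<^bsub>K\<^esub> b)" using x co(2) by metis
    also have "\<dots> = (\<Oplus>\<^bsub>L\<^esub>b\<in>B. h (co x b \<odot>\<^bsub>K\<^esub> b))"
      using hom.hom_finsum[OF cl] by (simp add: o_def)
    also have "\<dots> = (\<Oplus>\<^bsub>L\<^esub>b\<in>B. co x (g (h b)) \<odot>\<^bsub>L\<^esub> h b)"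
      using cl by (intro L.finsum_cong') (auto simp: ghB Ls Pi_iff)
    also have "\<dots> = (\<Oplus>\<^bsub>L\<^esub>v\<in>h ` B. co x (g v) \<odot>\<^bsub>L\<^esub> v)"
      using cl by (intro L.add.finprod_reindex[symmetric, OF _ injB]) (auto simp: ghB Ls Pi_iff)
    finally have "u = (\<Oplus>\<^bsub>L\<^esub>v\<in>h ` B. co x (g v) \<odot>\<^bsub>L\<^esub> v)" .
    moreover have "(\<lambda>v. co x (g v)) \<in> h ` B \<rightarrow> carrier F"
      using B co(1)[OF x(1)] by (auto simp: ghB)
    ultimately show "\<exists>c \<in> h ` B \<rightarrow> carrier F. u = (\<Oplus>\<^bsub>L\<^esub>v\<in>h ` B. c v \<odot>\<^bsub>L\<^esub> v)" by (rule bexI[of _ "\<lambda>v. co x (g v)"])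
  qed
  then have "finite_field_ext F L"
    using aL fL by (simp add: finite_field_ext_def fin_dim_algebra_def)
  with h hs show ?thesis by blast
qed

end

theory Submission
  imports Defs
begin

text \<open>
  The factors of \<open>a\<close> may be sought in any commutative subalgebra of \<open>A\<close> that contains \<open>a\<close>; the
  bicommutant of \<open>a\<close> is one (\<open>commutative_subalgebra_containing\<close>).

  A commutative finite-dimensional algebra is a finite direct product of local ones. Balanced
  factorisations of the components, all of length \<open>n\<close>, add up to one of the whole element, and it
  is non-power as soon as one component is (\<open>corner_orthogonal_sum\<close>).

  A local finite-dimensional algebra \<open>R\<close> has a nilpotent maximal ideal, and its residue field \<open>K\<close> is
  a finite extension of \<open>F\<close>, perhaps an inseparable one, so \<open>K\<close> need not embed into \<open>R\<close>.
  A factorisation in \<open>K\<close> is therefore lifted by Hensel's argument. Take \<open>n\<close> elements of \<open>R\<close> with sum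
  \<open>0\<close> whose product is \<open>a\<close> up to a nilpotent error. Replacing two of them, \<open>x\<close> and \<open>y\<close>, by
  \<open>x + t\<close> and \<open>y - t\<close> preserves the sum, and the product becomes \<open>a\<close> when \<open>t\<close> solves a quadratic
  equation whose linear coefficient is \<open>y - x\<close>, up to sign. A nilpotent solution exists when \<open>y - x\<close> and the other
  \<open>n - 2\<close> elements are units (\<open>lift_balanced_factorisation\<close>); this is
  where the non-power condition enters.

  So \<open>K\<close> has to provide factorisations with \<open>x \<noteq> y\<close> and the remaining factors nonzero
  (\<open>split_factorisation\<close>). For nonzero elements this is a non-power factorisation.
  For \<open>0\<close>, take \<open>y = 0\<close> and \<open>n - 1\<close> nonzero elements with sum \<open>0\<close>. These exist because \<open>K\<close> has more
  than two elements: over the field with two elements, \<open>1\<close> has no non-power factorisation.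
\<close>

section \<open>Spans and minimal subspaces\<close>

text \<open>
  An inductive span, rather than the finite sums of the definition of \<open>finitely_spanned\<close>: it does not
  mention the carrier of \<open>M\<close>, so it is the same set for \<open>M\<close> and for a subspace made into a module,
  and it comes with an induction rule.
\<close>

inductive_set lin_span ::
    "('a, 'm) ring_scheme \<Rightarrow> ('a, 'b, 'n) module_scheme \<Rightarrow> 'b set \<Rightarrow> 'b set"
  for F M B where
    zero: "\<zero>\<^bsub>M\<^esub> \<in> lin_span F M B"
  | step: "\<lbrakk>c \<in> carrier F; b \<in> B; v \<in> lin_span F M B\<rbrakk> \<Longrightarrow>
            c \<odot>\<^bsub>M\<^esub> b \<oplus>\<^bsub>M\<^esub> v \<in> lin_span F M B"

lemma lin_span_mono: "B \<subseteq> C \<Longrightarrow> lin_span F M B \<subseteq> lin_span F M C"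
proof
  fix v assume BC: "B \<subseteq> C" and "v \<in> lin_span F M B"
  from this(2) show "v \<in> lin_span F M C"
    by induction (use BC in \<open>auto intro: lin_span.intros\<close>)
qed

lemma lin_span_restrict_carrier:
  "lin_span F (M\<lparr>carrier := W, one := e\<rparr>) B = lin_span F M B"
proof -
  have "v \<in> lin_span F (M\<lparr>carrier := W, one := e\<rparr>) B \<longleftrightarrow> v \<in> lin_span F M B" for v
  proof
    show "v \<in> lin_span F M B" if "v \<in> lin_span F (M\<lparr>carrier := W, one := e\<rparr>) B"
      using that by induction (auto intro: lin_span.intros)
    show "v \<in> lin_span F (M\<lparr>carrier := W, one := e\<rparr>) B" if "v \<in> lin_span F M B"
      using that
    proof induction
      case zero
      then show ?case using lin_span.zero[of "M\<lparr>carrier := W, one := e\<rparr>"] by simp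
    next
      case (step c b v)
      then show ?case using lin_span.step[of c F b B v "M\<lparr>carrier := W, one := e\<rparr>"] by simp
    qed
  qed
  then show ?thesis by blast
qed

context module
begin

lemma lin_span_least:
  assumes "submodule W R M" "B \<subseteq> W"
  shows "lin_span R M B \<subseteq> W"
proof
  fix v assume "v \<in> lin_span R M B"
  then show "v \<in> W"
  proof induction
    case zero
    then show ?case using submodule.axioms(1)[OF assms(1)] subgroup.one_closed by fastforce
  next
    case (step c b v)
    then show ?case using submoduleE(4,5)[OF assms(1)] assms(2) by blast
  qed
qed

lemma lin_span_carrier: "B \<subseteq> carrier M \<Longrightarrow> lin_span R M B \<subseteq> carrier M"
  by (intro lin_span_least carrier_is_submodule)

lemma lin_span_submodule:
  assumes B: "B \<subseteq> carrier M"
  shows "submodule (lin_span R M B) R M"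
proof -
  have carr: "v \<in> carrier M" if "v \<in> lin_span R M B" for v
    using that B by induction auto
  have smult: "c \<odot>\<^bsub>M\<^esub> v \<in> lin_span R M B" if "c \<in> carrier R" "v \<in> lin_span R M B" for c v
    using that(2)
  proof induction
    case zero
    then show ?case using that(1) lin_span.zero by simp
  next
    case (step d b v)
    then have "c \<odot>\<^bsub>M\<^esub> (d \<odot>\<^bsub>M\<^esub> b \<oplus>\<^bsub>M\<^esub> v) = (c \<otimes> d) \<odot>\<^bsub>M\<^esub> b \<oplus>\<^bsub>M\<^esub> c \<odot>\<^bsub>M\<^esub> v"
      using B that(1) carr by (simp add: smult_r_distr smult_assoc1 subset_iff)
    then show ?case using step that(1) by (simp add: lin_span.step)
  qed
  show ?thesis
  proof (rule submoduleI)
    show "lin_span R M B \<subseteq> carrier M" using carr by blast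
    show "\<zero>\<^bsub>M\<^esub> \<in> lin_span R M B" by (rule lin_span.zero)
    show "\<ominus>\<^bsub>M\<^esub> v \<in> lin_span R M B" if "v \<in> lin_span R M B" for v
      using smult[of "\<ominus> \<one>" v] that carr smult_l_minus[of \<one> v] by simp
    show "u \<oplus>\<^bsub>M\<^esub> v \<in> lin_span R M B" if "u \<in> lin_span R M B" "v \<in> lin_span R M B" for u v
      using that(1)
    proof induction
      case zero
      then show ?case using that(2) carr by simp
    next
      case (step d b w)
      then show ?case
        using B that(2) carr by (simp add: M.a_assoc subset_iff lin_span.step)
    qed
  qed (rule smult)
qed

lemma lin_span_superset:
  assumes "B \<subseteq> carrier M"
  shows "B \<subseteq> lin_span R M B"
proof
  fix b assume "b \<in> B"
  then show "b \<in> lin_span R M B"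
    using lin_span.step[OF R.one_closed _ lin_span.zero, of b B M] assms by (auto simp: subset_iff)
qed

lemma lin_span_insertE:
  assumes "B \<subseteq> carrier M" "b \<in> carrier M" "v \<in> lin_span R M (insert b B)"
  obtains c w where "c \<in> carrier R" "w \<in> lin_span R M B" "v = c \<odot>\<^bsub>M\<^esub> b \<oplus>\<^bsub>M\<^esub> w"
proof -
  note sub = lin_span_carrier[OF assms(1)]
  have "\<exists>c\<in>carrier R. \<exists>w\<in>lin_span R M B. v = c \<odot>\<^bsub>M\<^esub> b \<oplus>\<^bsub>M\<^esub> w"
    using assms(3)
  proof induction
    case zero
    then show ?case
      using assms(2) by (intro bexI[of _ \<zero>] bexI[of _ "\<zero>\<^bsub>M\<^esub>"]) (auto intro: lin_span.zero)
  next
    case (step d b' v)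
    then obtain c w where v: "c \<in> carrier R" "w \<in> lin_span R M B" "v = c \<odot>\<^bsub>M\<^esub> b \<oplus>\<^bsub>M\<^esub> w" by blast
    show ?case
    proof (cases "b' = b")
      case True
      then show ?thesis
        using step v sub assms(2)
        by (intro bexI[of _ "d \<oplus> c"] bexI[of _ w]) (auto simp: smult_l_distr M.a_assoc)
    next
      case False
      then have "b' \<in> B" using step by simp
      then show ?thesis
        using step v sub assms
        by (intro bexI[of _ c] bexI[of _ "d \<odot>\<^bsub>M\<^esub> b' \<oplus>\<^bsub>M\<^esub> w"])
          (auto simp: M.a_lcomm subset_iff intro: lin_span.step)
    qed
  qed
  then show thesis using that by blast
qed

lemma finitely_spanned_iff_lin_span:
  "finitely_spanned R M \<longleftrightarrow> (\<exists>B. finite B \<and> B \<subseteq> carrier M \<and> lin_span R M B = carrier M)"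
proof
  assume "finitely_spanned R M"
  then obtain B where B: "finite B" "B \<subseteq> carrier M"
    and span: "\<And>x. x \<in> carrier M \<Longrightarrow> \<exists>c \<in> B \<rightarrow> carrier R. x = (\<Oplus>\<^bsub>M\<^esub>b\<in>B. c b \<odot>\<^bsub>M\<^esub> b)"
    unfolding finitely_spanned_def by blast
  have "(\<Oplus>\<^bsub>M\<^esub>b\<in>C. c b \<odot>\<^bsub>M\<^esub> b) \<in> lin_span R M B" if "C \<subseteq> B" "c \<in> B \<rightarrow> carrier R" for C c
    using finite_subset[OF that(1) B(1)] that
  proof (induction C rule: finite_induct)
    case empty
    then show ?case by (simp add: lin_span.zero)
  next
    case (insert b C)
    then have "(\<lambda>b. c b \<odot>\<^bsub>M\<^esub> b) \<in> C \<rightarrow> carrier M" "c b \<odot>\<^bsub>M\<^esub> b \<in> carrier M"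
      using B(2) by (auto simp: Pi_iff subset_iff)
    with insert show ?case
      by (simp add: Pi_iff lin_span.step)
  qed
  then have "carrier M \<subseteq> lin_span R M B" using span by blast
  with lin_span_carrier[OF B(2)] B show "\<exists>B. finite B \<and> B \<subseteq> carrier M \<and> lin_span R M B = carrier M"
    by blast
next
  assume "\<exists>B. finite B \<and> B \<subseteq> carrier M \<and> lin_span R M B = carrier M"
  then obtain B where B: "finite B" "B \<subseteq> carrier M" "lin_span R M B = carrier M" by blast
  have "\<exists>c \<in> B \<rightarrow> carrier R. x = (\<Oplus>\<^bsub>M\<^esub>b\<in>B. c b \<odot>\<^bsub>M\<^esub> b)" if "x \<in> lin_span R M B" for x
    using that
  proof induction
    case zero
    have "(\<Oplus>\<^bsub>M\<^esub>b\<in>B. \<zero> \<odot>\<^bsub>M\<^esub> b) = (\<Oplus>\<^bsub>M\<^esub>b\<in>B. \<zero>\<^bsub>M\<^esub>)"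
      using B(2) by (intro M.finsum_cong') auto
    then show ?case by (intro bexI[of _ "\<lambda>_. \<zero>"]) auto
  next
    case (step d b v)
    then obtain c where c: "c \<in> B \<rightarrow> carrier R" "v = (\<Oplus>\<^bsub>M\<^esub>b\<in>B. c b \<odot>\<^bsub>M\<^esub> b)" by blast
    define c' where "c' = c(b := d \<oplus> c b)"
    have B': "B = insert b (B - {b})" "finite (B - {b})" using step B by auto
    have carr: "(\<lambda>b. c b \<odot>\<^bsub>M\<^esub> b) \<in> B - {b} \<rightarrow> carrier M" "(\<lambda>b. c' b \<odot>\<^bsub>M\<^esub> b) \<in> B - {b} \<rightarrow> carrier M"
      "b \<in> carrier M" "c b \<in> carrier R"
      using B(2) c(1) step by (auto simp: c'_def Pi_iff subset_iff)
    have "(\<Oplus>\<^bsub>M\<^esub>b\<in>B. c' b \<odot>\<^bsub>M\<^esub> b) = c' b \<odot>\<^bsub>M\<^esub> b \<oplus>\<^bsub>M\<^esub> (\<Oplus>\<^bsub>M\<^esub>b\<in>B - {b}. c' b \<odot>\<^bsub>M\<^esub> b)"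
      using M.finsum_insert[OF B'(2), of b "\<lambda>b. c' b \<odot>\<^bsub>M\<^esub> b"] carr step B'(1)
      by (simp add: c'_def)
    also have "(\<Oplus>\<^bsub>M\<^esub>b\<in>B - {b}. c' b \<odot>\<^bsub>M\<^esub> b) = (\<Oplus>\<^bsub>M\<^esub>b\<in>B - {b}. c b \<odot>\<^bsub>M\<^esub> b)"
      using carr by (intro M.finsum_cong') (auto simp: c'_def)
    also have "c' b \<odot>\<^bsub>M\<^esub> b \<oplus>\<^bsub>M\<^esub> \<dots> = d \<odot>\<^bsub>M\<^esub> b \<oplus>\<^bsub>M\<^esub> (c b \<odot>\<^bsub>M\<^esub> b \<oplus>\<^bsub>M\<^esub> \<dots>)"
      using carr step by (simp add: c'_def smult_l_distr M.a_assoc)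
    also have "c b \<odot>\<^bsub>M\<^esub> b \<oplus>\<^bsub>M\<^esub> (\<Oplus>\<^bsub>M\<^esub>b\<in>B - {b}. c b \<odot>\<^bsub>M\<^esub> b) = v"
      using M.finsum_insert[OF B'(2), of b "\<lambda>b. c b \<odot>\<^bsub>M\<^esub> b"] carr B'(1) c(2)
      by simp
    finally have "(\<Oplus>\<^bsub>M\<^esub>b\<in>B. c' b \<odot>\<^bsub>M\<^esub> b) = d \<odot>\<^bsub>M\<^esub> b \<oplus>\<^bsub>M\<^esub> v" .
    moreover have "c' \<in> B \<rightarrow> carrier R" using c(1) step by (auto simp: c'_def Pi_iff)
    ultimately show ?case by metis
  qed
  then show "finitely_spanned R M" using B unfolding finitely_spanned_def by blast
qed

lemma submodule_Int:
  assumes "submodule V R M" "submodule W R M"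
  shows "submodule (V \<inter> W) R M"
  using assms submodule.axioms(1)[OF assms(1)] submodule.axioms(1)[OF assms(2)]
  by (intro submoduleI) (auto dest: submoduleE(1,3,4,5) simp: subgroup.one_closed[where G="add_monoid M", simplified])

end

text \<open>
  Induction on the spanning set. If \<open>W\<close> is not inside the span of \<open>B\<close>, some \<open>w\<close> in \<open>W\<close> has a nonzero
  coefficient at the new generator \<open>b\<close>; subtracting multiples of \<open>w\<close> moves every element of \<open>W\<close> into
  the span of \<open>B\<close>, so \<open>w\<close> together with generators of the intersection spans \<open>W\<close>. The clause on
  equal cardinalities replaces the strict monotonicity of dimension: it makes the smallest number of
  generators drop for a proper subspace.
\<close>

lemma submodule_spanned_by_fewer:
  assumes F: "field F" and "module F M"
    and "finite B" "B \<subseteq> carrier M" "submodule W F M" "W \<subseteq> lin_span F M B"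
  shows "\<exists>S. finite S \<and> S \<subseteq> W \<and> lin_span F M S = W \<and> card S \<le> card B \<and>
           (card S = card B \<longrightarrow> W = lin_span F M B)"
proof -
  interpret field F by (rule F)
  interpret module F M by (rule assms)
  show ?thesis
    using assms(3-)
  proof (induction B arbitrary: W rule: finite_induct)
    case empty
    have "lin_span F M {} = {\<zero>\<^bsub>M\<^esub>}"
      by (auto elim: lin_span.cases intro: lin_span.zero)
    moreover from this have "W = {\<zero>\<^bsub>M\<^esub>}"
      using submoduleE(2)[OF empty(2)] empty(3) subset_singletonD by metis
    ultimately show ?case by (intro exI[of _ "{}"]) auto
  next
    case (insert b B)
    then have b: "b \<in> carrier M" and B: "B \<subseteq> carrier M" by auto
    have WM: "W \<subseteq> carrier M" using submoduleE(1) insert by blast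
    note LB = lin_span_submodule[OF B]
    show ?case
    proof (cases "W \<subseteq> lin_span F M B")
      case True
      from insert.IH[OF B insert.prems(2) True] obtain S
        where "finite S" "S \<subseteq> W" "lin_span F M S = W" "card S \<le> card B" by blast
      then show ?thesis using insert.hyps by (intro exI[of _ S]) auto
    next
      case False
      then obtain w where w: "w \<in> W" "w \<notin> lin_span F M B" by blast
      then obtain c u where cu: "c \<in> carrier F" "u \<in> lin_span F M B" "w = c \<odot>\<^bsub>M\<^esub> b \<oplus>\<^bsub>M\<^esub> u"
        using lin_span_insertE[OF B b] insert.prems(3) by blast
      have uM: "u \<in> carrier M" using cu(2) lin_span_carrier[OF B] by blast
      have "c \<noteq> \<zero>\<^bsub>F\<^esub>" using cu w b uM by auto
      then have c: "inv\<^bsub>F\<^esub> c \<in> carrier F" "inv\<^bsub>F\<^esub> c \<otimes>\<^bsub>F\<^esub> c = \<one>\<^bsub>F\<^esub>"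
        using cu(1) field_Units by auto
      have "submodule (W \<inter> lin_span F M B) F M"
        using submodule_Int insert.prems(2) LB by blast
      from insert.IH[OF B this] obtain S where S: "finite S" "S \<subseteq> W \<inter> lin_span F M B"
          "lin_span F M S = W \<inter> lin_span F M B" "card S \<le> card B"
          "card S = card B \<Longrightarrow> W \<inter> lin_span F M B = lin_span F M B" by auto
      have SM: "S \<subseteq> carrier M" using S(2) WM by blast
      have ins: "insert w S \<subseteq> carrier M" using SM w WM by blast
      have sub: "lin_span F M (insert w S) \<subseteq> W"
        using S(2) w by (intro lin_span_least insert.prems(2)) auto
      have "W \<subseteq> lin_span F M (insert w S)"
      proof
        fix x assume x: "x \<in> W"
        then obtain d v where dv: "d \<in> carrier F" "v \<in> lin_span F M B" "x = d \<odot>\<^bsub>M\<^esub> b \<oplus>\<^bsub>M\<^esub> v"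
          using lin_span_insertE[OF B b] insert.prems(3) by blast
        \<comment> \<open>The multiple of \<open>w\<close> with the same coefficient at \<open>b\<close> as \<open>x\<close>.\<close>
        define k where "k = d \<otimes>\<^bsub>F\<^esub> inv\<^bsub>F\<^esub> c"
        have k: "k \<in> carrier F" "k \<otimes>\<^bsub>F\<^esub> c = d"
          using c cu(1) dv(1) by (simp_all add: k_def m_assoc)
        have vM: "v \<in> carrier M" using dv(2) lin_span_carrier[OF B] by blast
        have wM: "w \<in> carrier M" using w WM by blast
        define y where "y = v \<oplus>\<^bsub>M\<^esub> \<ominus>\<^bsub>M\<^esub> (k \<odot>\<^bsub>M\<^esub> u)"
        have yL: "y \<in> lin_span F M B"
          unfolding y_def using dv(2) cu(2) k submoduleE(3,4,5)[OF LB] by blast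
        have kw: "k \<odot>\<^bsub>M\<^esub> w = d \<odot>\<^bsub>M\<^esub> b \<oplus>\<^bsub>M\<^esub> k \<odot>\<^bsub>M\<^esub> u"
          using cu k uM b by (simp add: smult_r_distr smult_assoc1[symmetric])
        have "k \<odot>\<^bsub>M\<^esub> w \<oplus>\<^bsub>M\<^esub> y = x"
          unfolding kw y_def dv(3) using dv(1) b k uM vM
          by (simp add: M.a_ac M.r_neg2 M.r_neg M.r_neg1)
        then have xe: "x = k \<odot>\<^bsub>M\<^esub> w \<oplus>\<^bsub>M\<^esub> y" by simp
        have yM: "y \<in> carrier M" using yL lin_span_carrier[OF B] by blast
        have "y = x \<oplus>\<^bsub>M\<^esub> \<ominus>\<^bsub>M\<^esub> (k \<odot>\<^bsub>M\<^esub> w)"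
          unfolding xe using yM wM k by (simp add: M.a_ac M.r_neg2 M.r_neg M.r_neg1)
        then have "y \<in> W" using x w k submoduleE(3,4,5)[OF insert.prems(2)] by metis
        then have "y \<in> lin_span F M S" using yL S(3) by blast
        then have "y \<in> lin_span F M (insert w S)"
          using lin_span_mono[of S "insert w S" F M] by blast
        then show "x \<in> lin_span F M (insert w S)"
          unfolding xe using k(1) by (intro lin_span.step) auto
      qed
      with sub have span: "lin_span F M (insert w S) = W" by blast
      have wS: "w \<notin> S" using w S(2) by blast
      have "W = lin_span F M (insert b B)" if "card (insert w S) = card (insert b B)"
      proof
        have "card S = card B" using that wS S(1) insert.hyps by simp
        then have BW: "lin_span F M B \<subseteq> W" using S(5) by blast
        have "w \<oplus>\<^bsub>M\<^esub> \<ominus>\<^bsub>M\<^esub> u = c \<odot>\<^bsub>M\<^esub> b"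
          using cu(1) b uM by (simp add: cu(3) M.a_assoc M.r_neg)
        then have "c \<odot>\<^bsub>M\<^esub> b \<in> W"
          using w(1) BW cu(2) submoduleE(3,5)[OF insert.prems(2)] by (metis subsetD)
        then have "inv\<^bsub>F\<^esub> c \<odot>\<^bsub>M\<^esub> (c \<odot>\<^bsub>M\<^esub> b) \<in> W"
          using c submoduleE(4)[OF insert.prems(2)] by blast
        then have "b \<in> W" using c cu(1) b by (simp add: smult_assoc1[symmetric])
        then show "lin_span F M (insert b B) \<subseteq> W"
          using BW lin_span_superset[OF B] by (intro lin_span_least insert.prems(2)) auto
      qed (rule insert.prems(3))
      then show ?thesis
        using span S wS w(1) insert.hyps by (intro exI[of _ "insert w S"]) auto
    qed
  qed
qed

text \<open>
  The descending chain condition, in the form of a minimum principle. It is used twice: on the ideals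
  generated by powers of an element, to split units from nilpotent elements, and on ideals generated by idempotents,
  in place of an induction on dimension.
\<close>

lemma submodule_family_has_minimal:
  assumes "field F" "module F M" "finitely_spanned F M"
    and sub: "\<And>W. W \<in> \<W> \<Longrightarrow> submodule W F M" and ne: "\<W> \<noteq> {}"
  obtains W where "W \<in> \<W>" "\<And>V. \<lbrakk>V \<in> \<W>; V \<subseteq> W\<rbrakk> \<Longrightarrow> V = W"
proof -
  interpret module F M by fact
  define gen where
    "gen W k \<longleftrightarrow> (\<exists>S. finite S \<and> S \<subseteq> carrier M \<and> lin_span F M S = W \<and> card S = k)" for W k
  obtain B where B: "finite B" "B \<subseteq> carrier M" "lin_span F M B = carrier M"
    using assms(3) finitely_spanned_iff_lin_span by blast
  have ex: "\<exists>k. gen W k" if "W \<in> \<W>" for W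
  proof -
    note W = sub[OF that]
    have "W \<subseteq> carrier M" using submoduleE(1)[OF W] .
    then obtain S where "finite S" "S \<subseteq> W" "lin_span F M S = W"
      using submodule_spanned_by_fewer[OF assms(1,2) B(1,2) W] B(3) by auto
    with \<open>W \<subseteq> carrier M\<close> show ?thesis
      unfolding gen_def by (intro exI[of _ "card S"] exI[of _ S]) auto
  qed
  define k where "k = (LEAST k. \<exists>W\<in>\<W>. gen W k)"
  have "\<exists>W\<in>\<W>. gen W k"
    unfolding k_def by (rule LeastI_ex) (use ex ne in blast)
  then obtain W where W: "W \<in> \<W>" "gen W k" by blast
  show thesis
  proof (rule that[OF W(1)])
    fix V assume V: "V \<in> \<W>" "V \<subseteq> W"
    obtain S where S: "finite S" "S \<subseteq> carrier M" "lin_span F M S = W" "card S = k"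
      using W(2) unfolding gen_def by blast
    obtain T where T: "finite T" "T \<subseteq> V" "lin_span F M T = V" "card T \<le> k"
        "card T = k \<Longrightarrow> V = W"
      using submodule_spanned_by_fewer[OF assms(1,2) S(1,2) sub[OF V(1)]] V(2) S(3,4) by auto
    have "gen V (card T)"
      unfolding gen_def using T submoduleE(1)[OF sub[OF V(1)]] by blast
    then have "\<exists>W\<in>\<W>. gen W (card T)" using V(1) by blast
    then have "k \<le> card T" unfolding k_def by (rule Least_le)
    then show "V = W" using T by simp
  qed
qed

section \<open>Subalgebras and images of finite-dimensional algebras\<close>

text \<open>
  The subalgebra may have a unit \<open>e\<close> different from that of \<open>A\<close>, so that the statement covers ideals
  generated by idempotents as well as ordinary subalgebras.
\<close>

lemma fin_dim_subalgebra:
  assumes A: "fin_dim_algebra F A" and S: "submodule S F A"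
    and mult: "\<And>x y. \<lbrakk>x \<in> S; y \<in> S\<rbrakk> \<Longrightarrow> x \<otimes>\<^bsub>A\<^esub> y \<in> S"
    and e: "e \<in> S" "\<And>x. x \<in> S \<Longrightarrow> e \<otimes>\<^bsub>A\<^esub> x = x" "\<And>x. x \<in> S \<Longrightarrow> x \<otimes>\<^bsub>A\<^esub> e = x"
  shows "fin_dim_algebra F (A\<lparr>carrier := S, one := e\<rparr>)" (is "fin_dim_algebra F ?S")
proof -
  interpret alg: unital_assoc_algebra F A using A by (simp add: fin_dim_algebra_def)
  note SE = alg.submoduleE[OF S]
  have SA: "x \<in> carrier A" if "x \<in> S" for x using that SE(1) by blast
  have z: "\<zero>\<^bsub>A\<^esub> \<in> S" using submodule.axioms(1)[OF S] subgroup.one_closed by fastforce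
  have ab: "abelian_group ?S"
  proof (rule abelian_groupI)
    show "\<exists>y\<in>carrier ?S. y \<oplus>\<^bsub>?S\<^esub> x = \<zero>\<^bsub>?S\<^esub>" if "x \<in> carrier ?S" for x
      using that SE(3) SA by (intro bexI[of _ "\<ominus>\<^bsub>A\<^esub> x"]) (auto simp: alg.M.l_neg)
  qed (use SE(5) SA z in \<open>auto simp: alg.M.a_ac\<close>)
  have ring: "ring ?S"
    by (rule ringI[OF ab]; (rule monoidI)?)
      (use mult e SA in \<open>auto simp: alg.A.m_assoc alg.A.l_distr alg.A.r_distr\<close>)
  have mod: "module F ?S"
    by (rule moduleI[OF alg.F.is_cring ab])
      (use SE(4) SA in \<open>auto simp: alg.smult_l_distr alg.smult_r_distr alg.smult_assoc1\<close>)
  have alg': "unital_assoc_algebra F ?S"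
    by (intro unital_assoc_algebra.intro unital_assoc_algebra_axioms.intro alg.F.field_axioms mod ring)
      (use SA in \<open>auto simp: alg.smult_mult_left alg.smult_mult_right\<close>)
  obtain B where B: "finite B" "B \<subseteq> carrier A" "lin_span F A B = carrier A"
    using A alg.finitely_spanned_iff_lin_span by (auto simp: fin_dim_algebra_def)
  obtain T where T: "finite T" "T \<subseteq> S" "lin_span F A T = S"
    using submodule_spanned_by_fewer[OF alg.F.field_axioms alg.module_axioms B(1,2) S] B(3) SE(1)
    by auto
  have "finitely_spanned F ?S"
    unfolding module.finitely_spanned_iff_lin_span[OF mod] lin_span_restrict_carrier
    using T by auto
  with alg' show ?thesis by (simp add: fin_dim_algebra_def)
qed

lemma fin_dim_algebra_image:
  assumes A: "fin_dim_algebra F A" and L: "ring L" and h: "h \<in> ring_hom A L"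
    and surj: "h ` carrier A = carrier L"
    and smult: "\<And>c x. \<lbrakk>c \<in> carrier F; x \<in> carrier A\<rbrakk> \<Longrightarrow> h (c \<odot>\<^bsub>A\<^esub> x) = c \<odot>\<^bsub>L\<^esub> h x"
  shows "fin_dim_algebra F L"
proof -
  interpret alg: unital_assoc_algebra F A using A by (simp add: fin_dim_algebra_def)
  interpret L: ring L by fact
  interpret h: ring_hom_ring A L h
    by (intro ring_hom_ringI2 alg.A.ring_axioms L h)
  have ex: "\<exists>x\<in>carrier A. y = h x" if "y \<in> carrier L" for y using that surj by blast
  have cl: "c \<odot>\<^bsub>L\<^esub> y \<in> carrier L" if "c \<in> carrier F" "y \<in> carrier L" for c y
    using that(1) ex[OF that(2)] by (auto simp flip: smult)
  have mod: "module F L"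
  proof (rule moduleI[OF alg.F.is_cring L.is_abelian_group])
    fix a b x y
    assume "x \<in> carrier L"
    then obtain x' where x': "x' \<in> carrier A" "x = h x'" using ex by blast
    show "\<one>\<^bsub>F\<^esub> \<odot>\<^bsub>L\<^esub> x = x" using x' by (simp flip: smult)
    assume a: "a \<in> carrier F"
    show "a \<odot>\<^bsub>L\<^esub> x \<in> carrier L" using a x' cl by simp
    { assume b: "b \<in> carrier F"
      show "(a \<oplus>\<^bsub>F\<^esub> b) \<odot>\<^bsub>L\<^esub> x = a \<odot>\<^bsub>L\<^esub> x \<oplus>\<^bsub>L\<^esub> b \<odot>\<^bsub>L\<^esub> x"
        using a b x' by (simp add: alg.smult_l_distr flip: smult)
      show "(a \<otimes>\<^bsub>F\<^esub> b) \<odot>\<^bsub>L\<^esub> x = a \<odot>\<^bsub>L\<^esub> (b \<odot>\<^bsub>L\<^esub> x)"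
        using a b x' by (simp add: alg.smult_assoc1 flip: smult) }
    assume "y \<in> carrier L"
    then obtain y' where y': "y' \<in> carrier A" "y = h y'" using ex by blast
    have "a \<odot>\<^bsub>L\<^esub> (x \<oplus>\<^bsub>L\<^esub> y) = h (a \<odot>\<^bsub>A\<^esub> (x' \<oplus>\<^bsub>A\<^esub> y'))"
      using a x' y' smult[of a "x' \<oplus>\<^bsub>A\<^esub> y'"] by simp
    then show "a \<odot>\<^bsub>L\<^esub> (x \<oplus>\<^bsub>L\<^esub> y) = a \<odot>\<^bsub>L\<^esub> x \<oplus>\<^bsub>L\<^esub> a \<odot>\<^bsub>L\<^esub> y"
      using a x' y' by (simp add: alg.smult_r_distr smult)
  qed
  have alg': "unital_assoc_algebra F L"
  proof (intro unital_assoc_algebra.intro unital_assoc_algebra_axioms.intro alg.F.field_axioms mod L)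
    fix c x y assume c: "c \<in> carrier F" and "x \<in> carrier L" "y \<in> carrier L"
    then obtain x' y' where xy: "x' \<in> carrier A" "x = h x'" "y' \<in> carrier A" "y = h y'"
      using ex by metis
    have e: "c \<odot>\<^bsub>L\<^esub> (x \<otimes>\<^bsub>L\<^esub> y) = h (c \<odot>\<^bsub>A\<^esub> (x' \<otimes>\<^bsub>A\<^esub> y'))"
      using smult[of c "x' \<otimes>\<^bsub>A\<^esub> y'"] c xy by simp
    have "(c \<odot>\<^bsub>L\<^esub> x) \<otimes>\<^bsub>L\<^esub> y = h ((c \<odot>\<^bsub>A\<^esub> x') \<otimes>\<^bsub>A\<^esub> y')"
      using c xy by (simp add: smult)
    then show "(c \<odot>\<^bsub>L\<^esub> x) \<otimes>\<^bsub>L\<^esub> y = c \<odot>\<^bsub>L\<^esub> (x \<otimes>\<^bsub>L\<^esub> y)"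
      unfolding e using c xy by (simp add: alg.smult_mult_left)
    have "x \<otimes>\<^bsub>L\<^esub> (c \<odot>\<^bsub>L\<^esub> y) = h (x' \<otimes>\<^bsub>A\<^esub> (c \<odot>\<^bsub>A\<^esub> y'))"
      using c xy by (simp add: smult)
    then show "x \<otimes>\<^bsub>L\<^esub> (c \<odot>\<^bsub>L\<^esub> y) = c \<odot>\<^bsub>L\<^esub> (x \<otimes>\<^bsub>L\<^esub> y)"
      unfolding e using c xy by (simp add: alg.smult_mult_right)
  qed
  obtain B where B: "finite B" "B \<subseteq> carrier A" "lin_span F A B = carrier A"
    using A alg.finitely_spanned_iff_lin_span by (auto simp: fin_dim_algebra_def)
  have im: "h v \<in> lin_span F L (h ` B)" if "v \<in> lin_span F A B" for v
    using that
  proof induction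
    case zero
    then show ?case by (simp add: lin_span.zero)
  next
    case (step c b v)
    then have "b \<in> carrier A" "v \<in> carrier A" using B by auto
    with step show ?case by (simp add: smult lin_span.step)
  qed
  have "h ` B \<subseteq> carrier L" using B(2) by auto
  moreover have "lin_span F L (h ` B) = carrier L"
  proof
    show "lin_span F L (h ` B) \<subseteq> carrier L" by (rule module.lin_span_carrier[OF mod]) fact
    show "carrier L \<subseteq> lin_span F L (h ` B)"
      unfolding surj[symmetric] B(3)[symmetric] using im by (rule image_subsetI)
  qed
  ultimately have "finitely_spanned F L"
    unfolding module.finitely_spanned_iff_lin_span[OF mod]
    using B(1) by (intro exI[of _ "h ` B"]) simp
  with alg' show ?thesis by (simp add: fin_dim_algebra_def)
qed

lemma (in unital_assoc_algebra) principal_submodule: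
  assumes x: "x \<in> carrier A"
  shows "submodule ((\<otimes>\<^bsub>A\<^esub>) x ` carrier A) F A"
proof (rule submoduleI)
  show "\<zero>\<^bsub>A\<^esub> \<in> (\<otimes>\<^bsub>A\<^esub>) x ` carrier A"
    using x by (intro image_eqI[of _ _ "\<zero>\<^bsub>A\<^esub>"]) auto
  fix u assume "u \<in> (\<otimes>\<^bsub>A\<^esub>) x ` carrier A"
  then obtain u' where u: "u' \<in> carrier A" "u = x \<otimes>\<^bsub>A\<^esub> u'" by blast
  show "\<ominus>\<^bsub>A\<^esub> u \<in> (\<otimes>\<^bsub>A\<^esub>) x ` carrier A"
    using x u by (intro image_eqI[of _ _ "\<ominus>\<^bsub>A\<^esub> u'"]) (auto simp: A.r_minus)
  show "c \<odot>\<^bsub>A\<^esub> u \<in> (\<otimes>\<^bsub>A\<^esub>) x ` carrier A" if "c \<in> carrier F" for c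
    using x u that by (intro image_eqI[of _ _ "c \<odot>\<^bsub>A\<^esub> u'"]) (auto simp: smult_mult_right)
  fix v assume "v \<in> (\<otimes>\<^bsub>A\<^esub>) x ` carrier A"
  then obtain v' where v: "v' \<in> carrier A" "v = x \<otimes>\<^bsub>A\<^esub> v'" by blast
  show "u \<oplus>\<^bsub>A\<^esub> v \<in> (\<otimes>\<^bsub>A\<^esub>) x ` carrier A"
    using x u v by (intro image_eqI[of _ _ "u' \<oplus>\<^bsub>A\<^esub> v'"]) (auto simp: A.r_distr)
qed (use x in auto)

text \<open>
  The bicommutant of \<open>a\<close>: all elements that commute with everything that commutes with \<open>a\<close>.
  Since \<open>a\<close> commutes with itself, elements of the bicommutant commute with \<open>a\<close>, hence with each other.
  Unlike the subalgebra of polynomials in \<open>a\<close>, it needs no polynomials to be described.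
\<close>

lemma commutative_subalgebra_containing:
  assumes A: "fin_dim_algebra F A" and a: "a \<in> carrier A"
  obtains D where "a \<in> D" "D \<subseteq> carrier A" "\<one>\<^bsub>A\<^esub> \<in> D"
    "fin_dim_algebra F (A\<lparr>carrier := D, one := \<one>\<^bsub>A\<^esub>\<rparr>)" "cring (A\<lparr>carrier := D, one := \<one>\<^bsub>A\<^esub>\<rparr>)"
proof -
  interpret alg: unital_assoc_algebra F A using A by (simp add: fin_dim_algebra_def)
  define D where "D = {x \<in> carrier A. \<forall>y \<in> carrier A.
    a \<otimes>\<^bsub>A\<^esub> y = y \<otimes>\<^bsub>A\<^esub> a \<longrightarrow> x \<otimes>\<^bsub>A\<^esub> y = y \<otimes>\<^bsub>A\<^esub> x}"
  have DA: "D \<subseteq> carrier A" and aD: "a \<in> D" and oneD: "\<one>\<^bsub>A\<^esub> \<in> D" using a by (auto simp: D_def)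
  have comm: "x \<otimes>\<^bsub>A\<^esub> y = y \<otimes>\<^bsub>A\<^esub> x" if "x \<in> D" "y \<in> D" for x y
  proof -
    have "y \<otimes>\<^bsub>A\<^esub> a = a \<otimes>\<^bsub>A\<^esub> y" using that(2) a by (auto simp: D_def)
    then show ?thesis using that by (auto simp: D_def)
  qed
  have sub: "submodule D F A"
  proof (rule alg.submoduleI[OF DA])
    show "\<zero>\<^bsub>A\<^esub> \<in> D" by (auto simp: D_def)
    show "\<ominus>\<^bsub>A\<^esub> x \<in> D" if "x \<in> D" for x
      using that by (auto simp: D_def alg.A.l_minus alg.A.r_minus)
    show "x \<oplus>\<^bsub>A\<^esub> y \<in> D" if "x \<in> D" "y \<in> D" for x y
      using that by (auto simp: D_def alg.A.l_distr alg.A.r_distr)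
    show "c \<odot>\<^bsub>A\<^esub> x \<in> D" if "c \<in> carrier F" "x \<in> D" for c x
      using that by (auto simp: D_def alg.smult_mult_left alg.smult_mult_right)
  qed
  have mult: "x \<otimes>\<^bsub>A\<^esub> y \<in> D" if "x \<in> D" "y \<in> D" for x y
  proof -
    have "(x \<otimes>\<^bsub>A\<^esub> y) \<otimes>\<^bsub>A\<^esub> z = z \<otimes>\<^bsub>A\<^esub> (x \<otimes>\<^bsub>A\<^esub> y)"
      if z: "z \<in> carrier A" "a \<otimes>\<^bsub>A\<^esub> z = z \<otimes>\<^bsub>A\<^esub> a" for z
    proof -
      have xy: "x \<in> carrier A" "y \<in> carrier A" "x \<otimes>\<^bsub>A\<^esub> z = z \<otimes>\<^bsub>A\<^esub> x" "y \<otimes>\<^bsub>A\<^esub> z = z \<otimes>\<^bsub>A\<^esub> y"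
        using \<open>x \<in> D\<close> \<open>y \<in> D\<close> z by (auto simp: D_def)
      have "(x \<otimes>\<^bsub>A\<^esub> y) \<otimes>\<^bsub>A\<^esub> z = x \<otimes>\<^bsub>A\<^esub> (z \<otimes>\<^bsub>A\<^esub> y)"
        using xy z by (simp add: alg.A.m_assoc)
      also have "\<dots> = (x \<otimes>\<^bsub>A\<^esub> z) \<otimes>\<^bsub>A\<^esub> y" using xy(1,2) z(1) by (simp add: alg.A.m_assoc)
      also have "\<dots> = z \<otimes>\<^bsub>A\<^esub> (x \<otimes>\<^bsub>A\<^esub> y)" using xy z by (simp add: alg.A.m_assoc)
      finally show ?thesis .
    qed
    then show ?thesis using that DA by (auto simp: D_def)
  qed
  have fd: "fin_dim_algebra F (A\<lparr>carrier := D, one := \<one>\<^bsub>A\<^esub>\<rparr>)"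
    by (rule fin_dim_subalgebra[OF A sub mult oneD]) (use DA in auto)
  then interpret E: ring "A\<lparr>carrier := D, one := \<one>\<^bsub>A\<^esub>\<rparr>"
    by (simp add: fin_dim_algebra_def unital_assoc_algebra_def)
  have "cring (A\<lparr>carrier := D, one := \<one>\<^bsub>A\<^esub>\<rparr>)"
    by (intro cring.intro E.ring_axioms E.monoid_comm_monoidI) (use comm in auto)
  then show thesis using that aD DA oneD fd by blast
qed

section \<open>Lifting factorisations modulo nilpotent elements\<close>

context cring
begin

lemma nilpotent_mult:
  assumes "x \<in> carrier R" "y \<in> carrier R" "x [^] (n::nat) = \<zero>"
  shows "(x \<otimes> y) [^] n = \<zero>"
  using assms by (simp add: nat_pow_distrib)

lemma nat_pow_two_power_Suc:
  assumes "x \<in> carrier R"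
  shows "x [^] ((2::nat) ^ Suc k) = (x \<otimes> x) [^] ((2::nat) ^ k)"
  using assms by (simp add: nat_pow_distrib nat_pow_mult mult_2)

text \<open>
  Nilpotency is measured by exponents \<open>2^k\<close>, so that replacing an element by its square lowers \<open>k\<close> by
  one. Here \<open>1 - z\<close> divides \<open>1 - z\<^sup>2\<close>.
\<close>

lemma one_minus_nilpotent_unit:
  assumes "z \<in> carrier R" "z [^] ((2::nat) ^ k) = \<zero>"
  shows "\<one> \<ominus> z \<in> Units R"
  using assms
proof (induction k arbitrary: z)
  case 0
  then show ?case by (simp add: minus_eq)
next
  case (Suc k)
  have "(z \<otimes> z) [^] ((2::nat) ^ k) = \<zero>"
    using Suc.prems nat_pow_two_power_Suc by metis
  then have "\<one> \<ominus> z \<otimes> z \<in> Units R"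
    using Suc.prems(1) by (intro Suc.IH) simp_all
  moreover have "\<one> \<ominus> z \<otimes> z = (\<one> \<ominus> z) \<otimes> (\<one> \<oplus> z)"
    using Suc.prems(1) by algebra
  ultimately show ?case
    using Suc.prems(1) unit_factor[of "\<one> \<ominus> z" "\<one> \<oplus> z"] by simp
qed

end

context cring
begin

text \<open>
  Newton iteration for \<open>u\<^sup>2 - u = r\<close>, started at \<open>u = - r\<close>. With \<open>v = 1 + 2 r\<close>, the correction
  \<open>u = - r + v u'\<close> turns the equation into \<open>u'\<^sup>2 - u' = - r\<^sup>2 / v\<^sup>2\<close>, whose right-hand side is divisible by
  \<open>r\<^sup>2\<close> and so has a smaller nilpotency exponent. The root is obtained as a multiple of \<open>r\<close>, which
  makes it nilpotent again.
\<close>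

lemma nilpotent_quadratic_root:
  assumes "r \<in> carrier R" "r [^] ((2::nat) ^ k) = \<zero>"
  shows "\<exists>s\<in>carrier R. (r \<otimes> s) \<otimes> (r \<otimes> s) \<ominus> (r \<otimes> s) = r"
  using assms
proof (induction k arbitrary: r)
  case 0
  then show ?case by (intro bexI[of _ \<zero>]) (auto simp: minus_eq)
next
  case (Suc k)
  note r = Suc.prems(1)
  define v where "v = \<one> \<ominus> r \<otimes> \<ominus> (\<one> \<oplus> \<one>)"
  have "v \<in> Units R"
    unfolding v_def
    using r nilpotent_mult[OF r _ Suc.prems(2)] by (intro one_minus_nilpotent_unit[of _ "Suc k"]) simp_all
  define i where "i = inv v"
  have vi: "v \<in> carrier R" "i \<in> carrier R" "v \<otimes> i = \<one>"
    using \<open>v \<in> Units R\<close> by (auto simp: i_def)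
  define m where "m = \<ominus> (i \<otimes> i)"
  have m: "m \<in> carrier R" "v \<otimes> v \<otimes> m = \<ominus> \<one>"
  proof -
    show "m \<in> carrier R" using vi by (simp add: m_def)
    have "v \<otimes> v \<otimes> m = \<ominus> ((v \<otimes> i) \<otimes> (v \<otimes> i))" unfolding m_def using vi(1,2) by algebra
    then show "v \<otimes> v \<otimes> m = \<ominus> \<one>" by (simp add: vi(3))
  qed
  have "(r \<otimes> r) [^] ((2::nat) ^ k) = \<zero>"
    using Suc.prems nat_pow_two_power_Suc by metis
  then have "(r \<otimes> r \<otimes> m) [^] ((2::nat) ^ k) = \<zero>"
    using r m(1) nilpotent_mult[of "r \<otimes> r" m] by simp
  with Suc.IH[of "r \<otimes> r \<otimes> m"] r m(1) obtain s where s: "s \<in> carrier R"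
    and s': "(r \<otimes> r \<otimes> m \<otimes> s) \<otimes> (r \<otimes> r \<otimes> m \<otimes> s) \<ominus> (r \<otimes> r \<otimes> m \<otimes> s) = r \<otimes> r \<otimes> m"
    by auto
  \<comment> \<open>\<open>u\<close> solves the reduced equation; the root of the original one is \<open>v u - r = r t\<close>.\<close>
  define u where "u = r \<otimes> r \<otimes> m \<otimes> s"
  have u: "u \<in> carrier R" "u \<otimes> u \<ominus> u = r \<otimes> r \<otimes> m" using r m s s' by (simp_all add: u_def)
  define t where "t = \<ominus> \<one> \<oplus> v \<otimes> (r \<otimes> m \<otimes> s)"
  have t: "t \<in> carrier R" "r \<otimes> t = v \<otimes> u \<ominus> r"
  proof -
    show "t \<in> carrier R" using vi(1) r m(1) s by (simp add: t_def)
    show "r \<otimes> t = v \<otimes> u \<ominus> r" unfolding t_def u_def using vi(1) r m(1) s by algebra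
  qed
  have "(v \<otimes> u \<ominus> r) \<otimes> (v \<otimes> u \<ominus> r) \<ominus> (v \<otimes> u \<ominus> r) =
      v \<otimes> v \<otimes> (u \<otimes> u) \<ominus> v \<otimes> u \<otimes> (\<one> \<ominus> r \<otimes> \<ominus> (\<one> \<oplus> \<one>)) \<oplus> r \<otimes> r \<oplus> r"
    using vi(1) u(1) r by algebra
  also have "\<dots> = v \<otimes> v \<otimes> (u \<otimes> u \<ominus> u) \<oplus> r \<otimes> r \<oplus> r"
    unfolding v_def[symmetric] using vi(1) u(1) r by algebra
  also have "\<dots> = (v \<otimes> v \<otimes> m) \<otimes> (r \<otimes> r) \<oplus> r \<otimes> r \<oplus> r"
    unfolding u(2) using vi(1) m(1) r by algebra
  also have "\<dots> = r"
    unfolding m(2) using r by algebra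
  finally show ?case using t by (intro bexI[of _ t]) simp_all
qed

end

lemma (in comm_monoid) foldr_mult_closed:
  "set xs \<subseteq> carrier G \<Longrightarrow> foldr (\<otimes>) xs \<one> \<in> carrier G"
  by (induction xs) auto

lemma (in comm_monoid) foldr_mult_remove1:
  assumes "x \<in> set xs" "set xs \<subseteq> carrier G"
  shows "foldr (\<otimes>) xs \<one> = x \<otimes> foldr (\<otimes>) (remove1 x xs) \<one>"
  using assms
proof (induction xs)
  case (Cons y xs)
  have "foldr (\<otimes>) (remove1 x xs) \<one> \<in> carrier G"
    using Cons.prems set_remove1_subset[of x xs] by (intro foldr_mult_closed) auto
  with Cons show ?case by (auto simp: m_lcomm)
qed simp

lemma (in comm_monoid) foldr_mult_Units:
  "set xs \<subseteq> Units G \<Longrightarrow> foldr (\<otimes>) xs \<one> \<in> Units G"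
  by (induction xs) auto

lemma (in abelian_monoid) foldr_add_closed:
  "set xs \<subseteq> carrier G \<Longrightarrow> foldr (\<oplus>) xs \<zero> \<in> carrier G"
  by (induction xs) auto

context cring
begin

text \<open>
  Let \<open>P\<close> be the product of \<open>zs\<close> and \<open>q\<close> the error \<open>x y P - a\<close>. The product \<open>(x + t) (y - t) P\<close> equals
  \<open>a\<close> when \<open>t\<^sup>2 - (y - x) t = q / P\<close>, and \<open>t = (y - x) u\<close> reduces this to
  \<open>u\<^sup>2 - u = q / (P (y - x)\<^sup>2)\<close>. The result is non-power because the difference of its first two factors is
  \<open>y - x\<close> times a unit, up to sign.
\<close>

lemma lift_balanced_factorisation:
  assumes nz: "\<one> \<noteq> \<zero>"
    and carr: "a \<in> carrier R" "x \<in> carrier R" "y \<in> carrier R" and zs: "set zs \<subseteq> Units R"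
    and sum: "x \<oplus> (y \<oplus> foldr (\<oplus>) zs \<zero>) = \<zero>"
    and d: "y \<ominus> x \<in> Units R"
    and nilp: "(x \<otimes> (y \<otimes> foldr (\<otimes>) zs \<one>) \<ominus> a) [^] ((2::nat) ^ k) = \<zero>"
  shows "has_non_power_balanced_factorisation R (length zs + 2) a"
proof -
  define P where "P = foldr (\<otimes>) zs \<one>"
  define S where "S = foldr (\<oplus>) zs \<zero>"
  have zsc: "set zs \<subseteq> carrier R" using zs Units_closed by blast
  have P: "P \<in> Units R" "P \<in> carrier R" "inv P \<in> carrier R" "P \<otimes> inv P = \<one>"
    using foldr_mult_Units[OF zs] by (auto simp: P_def)
  have S: "S \<in> carrier R" unfolding S_def by (rule foldr_add_closed) fact
  define e where "e = inv (y \<ominus> x)"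
  have e: "e \<in> carrier R" "(y \<ominus> x) \<otimes> e = \<one>" using d by (auto simp: e_def)
  define q where "q = x \<otimes> (y \<otimes> P) \<ominus> a"
  have q: "q \<in> carrier R" using carr P by (simp add: q_def)
  define r where "r = q \<otimes> (inv P \<otimes> (e \<otimes> e))"
  have r: "r \<in> carrier R" "r [^] ((2::nat) ^ k) = \<zero>"
    using q e(1) P nilp unfolding r_def by (auto simp: q_def P_def intro!: nilpotent_mult)
  obtain s where s: "s \<in> carrier R" "(r \<otimes> s) \<otimes> (r \<otimes> s) \<ominus> (r \<otimes> s) = r"
    using nilpotent_quadratic_root[OF r] by blast
  define u where "u = r \<otimes> s"
  have u: "u \<in> carrier R" "u \<otimes> u \<ominus> u = r" using r s by (simp_all add: u_def)
  define t where "t = (y \<ominus> x) \<otimes> u"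
  have t: "t \<in> carrier R" using carr u by (simp add: t_def)
  have "t \<otimes> t \<ominus> (y \<ominus> x) \<otimes> t = (y \<ominus> x) \<otimes> (y \<ominus> x) \<otimes> (u \<otimes> u \<ominus> u)"
    unfolding t_def using carr u(1) by algebra
  also have "\<dots> = ((y \<ominus> x) \<otimes> e) \<otimes> ((y \<ominus> x) \<otimes> e) \<otimes> (q \<otimes> inv P)"
    unfolding u(2) r_def using carr e(1) q P(3) by algebra
  also have "\<dots> = q \<otimes> inv P" unfolding e(2) using q P(3) by simp
  finally have tt: "t \<otimes> t \<ominus> (y \<ominus> x) \<otimes> t = q \<otimes> inv P" .
  have "(x \<oplus> t) \<otimes> ((y \<ominus> t) \<otimes> P) = x \<otimes> (y \<otimes> P) \<ominus> (t \<otimes> t \<ominus> (y \<ominus> x) \<otimes> t) \<otimes> P"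
    using carr t P(2) by algebra
  also have "\<dots> = x \<otimes> (y \<otimes> P) \<ominus> q \<otimes> (P \<otimes> inv P)"
    unfolding tt using carr q P(2,3) by algebra
  also have "\<dots> = a" unfolding P(4) q_def using carr P(2) by algebra
  finally have prod: "(x \<oplus> t) \<otimes> ((y \<ominus> t) \<otimes> P) = a" .
  have "(x \<oplus> t) \<oplus> ((y \<ominus> t) \<oplus> S) = x \<oplus> (y \<oplus> S)" using carr t S by algebra
  then have sum': "(x \<oplus> t) \<oplus> ((y \<ominus> t) \<oplus> S) = \<zero>" using sum by (simp add: S_def)
  have "x \<oplus> t \<noteq> y \<ominus> t"
  proof
    assume eq: "x \<oplus> t = y \<ominus> t"
    have "(y \<ominus> x) \<otimes> (\<one> \<ominus> r \<otimes> (s \<otimes> (\<one> \<oplus> \<one>))) = (y \<ominus> t) \<ominus> (x \<oplus> t)"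
      unfolding t_def u_def using carr r s(1) by algebra
    also have "\<dots> = \<zero>" unfolding eq using carr t by algebra
    finally have "\<zero> = (y \<ominus> x) \<otimes> (\<one> \<ominus> r \<otimes> (s \<otimes> (\<one> \<oplus> \<one>)))" by simp
    moreover have "\<one> \<ominus> r \<otimes> (s \<otimes> (\<one> \<oplus> \<one>)) \<in> Units R"
      using r s(1) by (intro one_minus_nilpotent_unit[of _ k] nilpotent_mult) auto
    ultimately have "\<zero> \<in> Units R" using d by simp
    from Units_r_inv[OF this] Units_inv_closed[OF this] nz show False by simp
  qed
  then have "non_power ((x \<oplus> t) # (y \<ominus> t) # zs)" by (auto simp: non_power_def)
  moreover have "balanced_factorisation R ((x \<oplus> t) # (y \<ominus> t) # zs) a"
    using carr t zsc prod sum' by (simp add: balanced_factorisation_def P_def S_def)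
  ultimately show ?thesis
    unfolding has_non_power_balanced_factorisation_def
    by (intro exI[of _ "(x \<oplus> t) # (y \<ominus> t) # zs"]) simp
qed

end

section \<open>Factorisations in fields\<close>

context field
begin

text \<open>
  A field with two distinct nonzero elements has, besides \<open>0\<close> and \<open>s\<close>, a further element \<open>x\<close>, and
  \<open>s = x + (s - x)\<close> settles two summands. Over the field with two elements \<open>1\<close> is not a sum of two nonzero elements.
\<close>

lemma sum_of_nonzero_elements:
  assumes c: "c \<in> carrier R - {\<zero>}" "d \<in> carrier R - {\<zero>}" "c \<noteq> d" and s: "s \<in> carrier R"
  shows "\<exists>ws. length ws = m + 2 \<and> set ws \<subseteq> carrier R - {\<zero>} \<and> foldr (\<oplus>) ws \<zero> = s"
  using s
proof (induction m arbitrary: s)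
  case 0
  obtain x where x: "x \<in> carrier R" "x \<noteq> \<zero>" "x \<noteq> s" using c by blast
  have "s \<ominus> x \<noteq> \<zero>" using x 0 r_right_minus_eq by auto
  moreover have "x \<oplus> (s \<ominus> x) = s" using x(1) 0 by algebra
  ultimately show ?case using x 0 by (intro exI[of _ "[x, s \<ominus> x]"]) simp
next
  case (Suc m)
  have "\<one> \<oplus> (s \<ominus> \<one>) = s" using Suc.prems by algebra
  moreover obtain ws where "length ws = m + 2" "set ws \<subseteq> carrier R - {\<zero>}" "foldr (\<oplus>) ws \<zero> = s \<ominus> \<one>"
    using Suc.IH[of "s \<ominus> \<one>"] Suc.prems by auto
  ultimately show ?case by (intro exI[of _ "\<one> # ws"]) simp
qed

lemma foldr_mult_nonzero:
  assumes "set xs \<subseteq> carrier R" "foldr (\<otimes>) xs \<one> \<noteq> \<zero>"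
  shows "\<zero> \<notin> set xs"
  using assms
proof (induction xs)
  case (Cons x xs)
  then have "foldr (\<otimes>) xs \<one> \<in> carrier R" by (intro foldr_mult_closed) simp
  with Cons show ?case by (cases "foldr (\<otimes>) xs \<one> = \<zero>") auto
qed simp

text \<open>
  A factorisation in the form that can be lifted from the residue field. For \<open>a \<noteq> 0\<close> all factors of a
  non-power factorisation are nonzero, and two distinct ones are moved to the front. For \<open>a = 0\<close> the
  given factorisation may have several zero factors, and then changing two factors need not repair the
  product; a new one with the single zero
  factor \<open>y\<close> is built from nonzero elements with sum \<open>0\<close>.
\<close>

lemma split_factorisation:
  assumes "n > 2"
    and fac: "\<forall>a \<in> carrier R. has_non_power_balanced_factorisation R n a"
    and a: "a \<in> carrier R"
  obtains x y zs where "length zs + 2 = n" "x \<in> carrier R" "y \<in> carrier R" "x \<noteq> y"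
    "set zs \<subseteq> carrier R - {\<zero>}" "x \<oplus> (y \<oplus> foldr (\<oplus>) zs \<zero>) = \<zero>"
    "x \<otimes> (y \<otimes> foldr (\<otimes>) zs \<one>) = a"
proof -
  have nonzero: "\<exists>xs x y. length xs = n \<and> balanced_factorisation R xs b \<and> set xs \<subseteq> carrier R - {\<zero>} \<and>
      x \<in> set xs \<and> y \<in> set xs \<and> x \<noteq> y" if "b \<in> carrier R" "b \<noteq> \<zero>" for b
  proof -
    have "has_non_power_balanced_factorisation R n b" using that(1) fac by blast
    then obtain xs where xs: "length xs = n" "balanced_factorisation R xs b" "non_power xs"
      by (auto simp: has_non_power_balanced_factorisation_def)
    then have "set xs \<subseteq> carrier R - {\<zero>}"
      using foldr_mult_nonzero[of xs] \<open>b \<noteq> \<zero>\<close> by (auto simp: balanced_factorisation_def)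
    with xs show ?thesis by (auto simp: non_power_def)
  qed
  show thesis
  proof (cases "a = \<zero>")
    case False
    obtain xs x y where xs: "length xs = n" "balanced_factorisation R xs a"
        "set xs \<subseteq> carrier R - {\<zero>}" "x \<in> set xs" "y \<in> set xs" "x \<noteq> y"
      using nonzero[OF a False] by blast
    define ys where "ys = remove1 x xs"
    define zs where "zs = remove1 y ys"
    have xc: "set xs \<subseteq> carrier R" using xs(3) by blast
    have y: "y \<in> set ys" using xs(5,6) by (simp add: ys_def in_set_remove1)
    have sub: "set ys \<subseteq> set xs" "set zs \<subseteq> set ys"
      using set_remove1_subset by (auto simp: ys_def zs_def dest: subsetD[OF set_remove1_subset])
    have yc: "set ys \<subseteq> carrier R" using sub xc by blast
    have "length zs + 2 = n"
      using xs(1,4) y \<open>n > 2\<close> by (simp add: ys_def zs_def length_remove1)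
    moreover have "x \<oplus> (y \<oplus> foldr (\<oplus>) zs \<zero>) = \<zero>"
      using add.foldr_mult_remove1[of x xs] add.foldr_mult_remove1[of y ys] xs(2,4) xc y yc
      by (simp add: balanced_factorisation_def ys_def[symmetric] zs_def[symmetric])
    moreover have "x \<otimes> (y \<otimes> foldr (\<otimes>) zs \<one>) = a"
      using foldr_mult_remove1[of x xs] foldr_mult_remove1[of y ys] xs(2,4) xc y yc
      by (simp add: balanced_factorisation_def ys_def[symmetric] zs_def[symmetric])
    moreover have "set zs \<subseteq> carrier R - {\<zero>}" "x \<in> carrier R" "y \<in> carrier R" using sub xs by auto
    ultimately show thesis using that xs(6) by blast
  next
    case True
    obtain c d where cd: "c \<in> carrier R - {\<zero>}" "d \<in> carrier R - {\<zero>}" "c \<noteq> d"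
      using nonzero[of \<one>] by auto
    \<comment> \<open>\<open>n - 1\<close> nonzero elements; the remaining factor is \<open>0\<close>.\<close>
    obtain ws where ws: "length ws = (n - 3) + 2" "set ws \<subseteq> carrier R - {\<zero>}" "foldr (\<oplus>) ws \<zero> = \<zero>"
      using sum_of_nonzero_elements[OF cd zero_closed] by blast
    obtain w zs where w: "ws = w # zs" using ws(1) by (cases ws) auto
    have zsc: "set zs \<subseteq> carrier R" using ws(2) w by auto
    show thesis
    proof (rule that[of zs w \<zero>])
      show "length zs + 2 = n" using ws(1) w \<open>n > 2\<close> by simp
      show "w \<oplus> (\<zero> \<oplus> foldr (\<oplus>) zs \<zero>) = \<zero>"
        using ws(3) w foldr_add_closed[OF zsc] by simp
      show "w \<otimes> (\<zero> \<otimes> foldr (\<otimes>) zs \<one>) = a"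
        using ws(2) w foldr_mult_closed[OF zsc] True by simp
    qed (use ws(2) w in auto)
  qed
qed

end

section \<open>Local algebras\<close>

text \<open>
  Fitting's argument. The ideals generated by \<open>x^(2^k)\<close> become stationary, so \<open>p = x^(2^k)\<close> satisfies
  \<open>p = p\<^sup>2 y\<close> for some \<open>k\<close> and \<open>y\<close>. Then \<open>p y\<close> is idempotent and \<open>p = p (p y)\<close>; if \<open>p y = 0\<close> then \<open>p = 0\<close>,
  and if \<open>p y = 1\<close> then \<open>x\<close> divides a unit.
\<close>

lemma unit_or_nilpotent:
  assumes A: "fin_dim_algebra F A" and "cring A"
    and loc: "\<And>e. \<lbrakk>e \<in> carrier A; e \<otimes>\<^bsub>A\<^esub> e = e\<rbrakk> \<Longrightarrow> e = \<zero>\<^bsub>A\<^esub> \<or> e = \<one>\<^bsub>A\<^esub>"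
    and x: "x \<in> carrier A"
  shows "x \<in> Units A \<or> (\<exists>k::nat. x [^]\<^bsub>A\<^esub> ((2::nat) ^ k) = \<zero>\<^bsub>A\<^esub>)"
proof -
  interpret alg: unital_assoc_algebra F A using A by (simp add: fin_dim_algebra_def)
  interpret C: cring A by fact
  define I where "I k = (\<otimes>\<^bsub>A\<^esub>) (x [^]\<^bsub>A\<^esub> ((2::nat) ^ k)) ` carrier A" for k :: nat
  have "submodule W F A" if "W \<in> range I" for W
    using that x alg.principal_submodule by (auto simp: I_def)
  moreover have "finitely_spanned F A" using A by (simp add: fin_dim_algebra_def)
  ultimately obtain W where W: "W \<in> range I" "\<And>V. \<lbrakk>V \<in> range I; V \<subseteq> W\<rbrakk> \<Longrightarrow> V = W"
    using submodule_family_has_minimal[OF alg.F.field_axioms alg.module_axioms, of "range I"]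
    by blast
  then obtain k where k: "W = I k" by blast
  define p where "p = x [^]\<^bsub>A\<^esub> ((2::nat) ^ k)"
  have p: "p \<in> carrier A" using x by (simp add: p_def)
  have pp: "x [^]\<^bsub>A\<^esub> ((2::nat) ^ Suc k) = p \<otimes>\<^bsub>A\<^esub> p"
    using x by (simp add: p_def alg.A.nat_pow_mult mult_2)
  have "I (Suc k) \<subseteq> I k"
    unfolding I_def pp p_def[symmetric] using p by (auto simp: alg.A.m_assoc)
  then have eq: "I (Suc k) = I k" using W(2)[of "I (Suc k)"] k by blast
  have "p \<in> I k" unfolding I_def p_def[symmetric] using p by (intro image_eqI[of _ _ "\<one>\<^bsub>A\<^esub>"]) auto
  then have "p \<in> I (Suc k)" by (simp only: eq)
  then have "p \<in> (\<otimes>\<^bsub>A\<^esub>) (p \<otimes>\<^bsub>A\<^esub> p) ` carrier A" by (simp only: I_def pp)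
  then obtain y where y: "p = p \<otimes>\<^bsub>A\<^esub> p \<otimes>\<^bsub>A\<^esub> y" "y \<in> carrier A" by (rule imageE)
  define e where "e = p \<otimes>\<^bsub>A\<^esub> y"
  have e: "e \<in> carrier A" "p \<otimes>\<^bsub>A\<^esub> e = p"
    using p y(2) y(1)[symmetric] by (simp_all add: e_def alg.A.m_assoc[symmetric])
  have "e \<otimes>\<^bsub>A\<^esub> e = p \<otimes>\<^bsub>A\<^esub> e \<otimes>\<^bsub>A\<^esub> y" using p y(2) by (simp add: e_def C.m_ac)
  also have "\<dots> = e" using e(2) by (simp add: e_def)
  finally consider "e = \<zero>\<^bsub>A\<^esub>" | "e = \<one>\<^bsub>A\<^esub>" using loc[OF e(1)] by blast
  then show ?thesis
  proof cases
    case 1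
    then have "p = \<zero>\<^bsub>A\<^esub>" using e(2) p by simp
    then show ?thesis unfolding p_def by blast
  next
    case 2
    obtain m where m: "(2::nat) ^ k = Suc m" 
      using not0_implies_Suc[of "2 ^ k"] by auto
    have "x \<otimes>\<^bsub>A\<^esub> (x [^]\<^bsub>A\<^esub> m \<otimes>\<^bsub>A\<^esub> y) = \<one>\<^bsub>A\<^esub>"
      using 2 x y(2) by (simp add: e_def p_def m C.m_ac)
    then have "x \<otimes>\<^bsub>A\<^esub> (x [^]\<^bsub>A\<^esub> m \<otimes>\<^bsub>A\<^esub> y) \<in> Units A" by simp
    then have "x \<in> Units A" by (rule C.unit_factor) (use x y(2) in auto)
    then show ?thesis ..
  qed
qed

text \<open>
  The non-units form an ideal \<open>N\<close>: if \<open>x + y\<close> were a unit, say with inverse \<open>w\<close>, then \<open>y w\<close> is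
  nilpotent and \<open>x w = 1 - y w\<close> is a unit, and so is \<open>x\<close>. The quotient by \<open>N\<close> is a field because everything outside
  \<open>N\<close> is a unit, and it is moved to the element type \<open>'a list\<close> by \<open>finite_field_ext_copy\<close>.
\<close>

lemma residue_field_extension:
  fixes F :: "('a, 'm) ring_scheme" and A :: "('a, 'b, 'n) module_scheme"
  assumes A: "fin_dim_algebra F A" and "cring A" and nz: "\<one>\<^bsub>A\<^esub> \<noteq> \<zero>\<^bsub>A\<^esub>"
    and loc: "\<And>e. \<lbrakk>e \<in> carrier A; e \<otimes>\<^bsub>A\<^esub> e = e\<rbrakk> \<Longrightarrow> e = \<zero>\<^bsub>A\<^esub> \<or> e = \<one>\<^bsub>A\<^esub>"
  obtains K :: "('a, 'a list) module" and \<pi> where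
    "finite_field_ext F K" "\<pi> \<in> ring_hom A K" "\<pi> ` carrier A = carrier K"
    "\<And>x. x \<in> carrier A \<Longrightarrow> \<pi> x = \<zero>\<^bsub>K\<^esub> \<longleftrightarrow> x \<notin> Units A"
proof -
  interpret C: cring A by fact
  interpret alg: unital_assoc_algebra F A using A by (simp add: fin_dim_algebra_def)
  define N where "N = carrier A - Units A"
  have factor: "x \<in> Units A" if "x \<otimes>\<^bsub>A\<^esub> y \<in> Units A" "x \<in> carrier A" "y \<in> carrier A" for x y
    using that C.unit_factor by blast
  have zero: "\<zero>\<^bsub>A\<^esub> \<notin> Units A"
  proof
    assume "\<zero>\<^bsub>A\<^esub> \<in> Units A"
    from C.Units_r_inv[OF this] C.Units_inv_closed[OF this] nz show False by simp
  qed
  have sum: "x \<oplus>\<^bsub>A\<^esub> y \<in> N" if "x \<in> N" "y \<in> N" for x y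
  proof (rule ccontr)
    assume "x \<oplus>\<^bsub>A\<^esub> y \<notin> N"
    with that have xy: "x \<in> carrier A" "y \<in> carrier A" "x \<oplus>\<^bsub>A\<^esub> y \<in> Units A" by (auto simp: N_def)
    define w where "w = inv\<^bsub>A\<^esub> (x \<oplus>\<^bsub>A\<^esub> y)"
    have w: "w \<in> carrier A" "w \<otimes>\<^bsub>A\<^esub> (x \<oplus>\<^bsub>A\<^esub> y) = \<one>\<^bsub>A\<^esub>"
      using xy(3) by (simp_all add: w_def)
    have "y \<otimes>\<^bsub>A\<^esub> w \<notin> Units A" using factor[of y w] that(2) w xy by (auto simp: N_def)
    then obtain k where "(y \<otimes>\<^bsub>A\<^esub> w) [^]\<^bsub>A\<^esub> ((2::nat) ^ k) = \<zero>\<^bsub>A\<^esub>"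
      using unit_or_nilpotent[OF A \<open>cring A\<close> loc, of "y \<otimes>\<^bsub>A\<^esub> w"] w xy by auto
    then have "\<one>\<^bsub>A\<^esub> \<ominus>\<^bsub>A\<^esub> y \<otimes>\<^bsub>A\<^esub> w \<in> Units A"
      using w xy by (intro C.one_minus_nilpotent_unit) auto
    moreover have "\<one>\<^bsub>A\<^esub> \<ominus>\<^bsub>A\<^esub> y \<otimes>\<^bsub>A\<^esub> w = x \<otimes>\<^bsub>A\<^esub> w"
      unfolding w(2)[symmetric] using w(1) xy(1,2) by algebra
    ultimately show False using factor[of x w] that(1) w xy by (auto simp: N_def)
  qed
  have mult: "x \<otimes>\<^bsub>A\<^esub> y \<in> N" if "x \<in> N" "y \<in> carrier A" for x y
    using that factor[of x y] by (auto simp: N_def)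
  interpret N: ideal N A
  proof (rule idealI[OF C.ring_axioms])
    show "subgroup N (add_monoid A)"
    proof (rule C.add.subgroupI)
      show "N \<noteq> {}" using zero by (auto simp: N_def)
      show "\<ominus>\<^bsub>A\<^esub> x \<in> N" if "x \<in> N" for x
      proof -
        have "\<ominus>\<^bsub>A\<^esub> x = x \<otimes>\<^bsub>A\<^esub> \<ominus>\<^bsub>A\<^esub> \<one>\<^bsub>A\<^esub>" using that by (simp add: N_def C.r_minus)
        then show ?thesis using mult[OF that, of "\<ominus>\<^bsub>A\<^esub> \<one>\<^bsub>A\<^esub>"] by simp
      qed
    qed (use sum in \<open>auto simp: N_def\<close>)
    show "x \<otimes>\<^bsub>A\<^esub> a \<in> N" if "a \<in> N" "x \<in> carrier A" for a x
      using mult[OF that] that C.m_comm[of x a] by (auto simp: N_def)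
  qed (rule mult)
  define Q where "Q = A Quot N"
  define h where "h x = N +>\<^bsub>A\<^esub> x" for x
  have hom: "h \<in> ring_hom A Q"
    using N.rcos_ring_hom by (simp add: h_def[abs_def] Q_def)
  interpret Q: cring Q unfolding Q_def by (rule N.quotient_is_cring) fact
  interpret h: ring_hom_cring A Q h
    by (intro ring_hom_cring.intro ring_hom_cring_axioms.intro C.is_cring Q.is_cring hom)
  have surj: "h ` carrier A = carrier Q"
    by (auto simp: Q_def h_def FactRing_simps)
  have ker: "h x = \<zero>\<^bsub>Q\<^esub> \<longleftrightarrow> x \<notin> Units A" if "x \<in> carrier A" for x
  proof -
    have "h x = \<zero>\<^bsub>Q\<^esub> \<longleftrightarrow> x \<in> N"
      using that N.rcos_const_imp_mem C.a_rcos_zero[OF N.is_ideal]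
      by (auto simp: h_def Q_def FactRing_def)
    then show ?thesis using that by (auto simp: N_def)
  qed
  have fQ: "field Q"
  proof (rule Q.cring_fieldI2)
    show "\<zero>\<^bsub>Q\<^esub> \<noteq> \<one>\<^bsub>Q\<^esub>" using ker[of "\<one>\<^bsub>A\<^esub>"] by auto
    fix u assume u: "u \<in> carrier Q" "u \<noteq> \<zero>\<^bsub>Q\<^esub>"
    then obtain x where x: "x \<in> carrier A" "u = h x" using surj by blast
    then have xU: "x \<in> Units A" using ker u by blast
    then have "h x \<otimes>\<^bsub>Q\<^esub> h (inv\<^bsub>A\<^esub> x) = \<one>\<^bsub>Q\<^esub>"
      using x by (simp flip: h.hom_mult)
    then show "\<exists>v\<in>carrier Q. u \<otimes>\<^bsub>Q\<^esub> v = \<one>\<^bsub>Q\<^esub>" using x xU by auto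
  qed
  define Qm :: "('a, 'b set) module" where
    "Qm = \<lparr>carrier = carrier Q, monoid.mult = (\<otimes>\<^bsub>Q\<^esub>), one = \<one>\<^bsub>Q\<^esub>, ring.zero = \<zero>\<^bsub>Q\<^esub>,
           ring.add = (\<oplus>\<^bsub>Q\<^esub>), module.smult = \<lambda>c u. h (c \<odot>\<^bsub>A\<^esub> \<one>\<^bsub>A\<^esub>) \<otimes>\<^bsub>Q\<^esub> u\<rparr>"
  \<comment> \<open>\<open>Qm\<close> is \<open>Q\<close> with scalar multiplication added; the identity carries the field axioms over.\<close>
  have "id \<in> ring_iso Q Qm"
    by (auto simp: ring_iso_def ring_hom_def Qm_def)
  from field.ring_iso_imp_img_field[OF fQ this] have fQm: "field Qm"
    by (simp add: Qm_def)
  interpret Qm: field Qm by (rule fQm)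
  have "fin_dim_algebra F Qm"
  proof (rule fin_dim_algebra_image[OF A Qm.ring_axioms])
    show "h \<in> ring_hom A Qm" using hom by (simp add: ring_hom_def Qm_def)
    show "h ` carrier A = carrier Qm" using surj by (simp add: Qm_def)
    show "h (c \<odot>\<^bsub>A\<^esub> x) = c \<odot>\<^bsub>Qm\<^esub> h x" if "c \<in> carrier F" "x \<in> carrier A" for c x
      using that by (simp add: Qm_def alg.smult_mult_left flip: h.hom_mult)
  qed
  with fQm have "finite_field_ext F Qm" by (simp add: finite_field_ext_def)
  from finite_field_ext_copy[OF this] obtain K :: "('a, 'a list) module" and g
    where K: "finite_field_ext F K" and g: "g \<in> ring_iso Qm K" by blast
  interpret K: field K using K by (simp add: finite_field_ext_def)
  have g': "g \<in> ring_hom Q K" "bij_betw g (carrier Q) (carrier K)"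
    using g by (auto simp: ring_iso_def Qm_def ring_hom_def)
  interpret g: ring_hom_cring Q K g
    by (intro ring_hom_cring.intro ring_hom_cring_axioms.intro Q.is_cring K.is_cring g')
  show thesis
  proof (rule that[OF K])
    show "g \<circ> h \<in> ring_hom A K" by (rule ring_hom_trans[OF hom g'(1)])
    show "(g \<circ> h) ` carrier A = carrier K"
      using g'(2) by (simp only: bij_betw_def image_comp[symmetric] surj)
    show "(g \<circ> h) x = \<zero>\<^bsub>K\<^esub> \<longleftrightarrow> x \<notin> Units A" if "x \<in> carrier A" for x
    proof -
      have "g (h x) = \<zero>\<^bsub>K\<^esub> \<longleftrightarrow> h x = \<zero>\<^bsub>Q\<^esub>"
        using g'(2) that inj_onD[of g "carrier Q" "h x" "\<zero>\<^bsub>Q\<^esub>"] by (auto simp: bij_betw_def)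
      then show ?thesis using ker[OF that] by simp
    qed
  qed
qed

text \<open>
  The factors of the residue field are lifted arbitrarily, except for one, which is chosen to make the
  sum exactly \<open>0\<close>; the product is then \<open>a\<close> up to an element of the maximal ideal, which is nilpotent.
\<close>

lemma local_algebra_factorisation:
  fixes F :: "('a, 'm) ring_scheme" and A :: "('a, 'b, 'n) module_scheme"
  assumes A: "fin_dim_algebra F A" and "cring A" and nz: "\<one>\<^bsub>A\<^esub> \<noteq> \<zero>\<^bsub>A\<^esub>"
    and loc: "\<And>e. \<lbrakk>e \<in> carrier A; e \<otimes>\<^bsub>A\<^esub> e = e\<rbrakk> \<Longrightarrow> e = \<zero>\<^bsub>A\<^esub> \<or> e = \<one>\<^bsub>A\<^esub>"
    and "n > 2"
    and ext: "\<And>K :: ('a, 'a list) module. finite_field_ext F K \<Longrightarrow>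
           \<forall>x \<in> carrier K. has_non_power_balanced_factorisation K n x"
    and a: "a \<in> carrier A"
  shows "has_non_power_balanced_factorisation A n a"
proof -
  interpret C: cring A by fact
  obtain K :: "('a, 'a list) module" and \<pi> where
    K: "finite_field_ext F K" and hom: "\<pi> \<in> ring_hom A K" and surj: "\<pi> ` carrier A = carrier K"
    and ker: "\<And>x. x \<in> carrier A \<Longrightarrow> \<pi> x = \<zero>\<^bsub>K\<^esub> \<longleftrightarrow> x \<notin> Units A"
    using residue_field_extension[OF A \<open>cring A\<close> nz loc] by blast
  interpret K: field K using K by (simp add: finite_field_ext_def)
  interpret \<pi>: ring_hom_cring A K \<pi>
    by (intro ring_hom_cring.intro ring_hom_cring_axioms.intro C.is_cring K.is_cring hom)
  have "\<pi> a \<in> carrier K" using a by simp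
  then obtain x' y' zs' where fac: "length zs' + 2 = n" "x' \<in> carrier K" "y' \<in> carrier K" "x' \<noteq> y'"
    "set zs' \<subseteq> carrier K - {\<zero>\<^bsub>K\<^esub>}"
    "x' \<oplus>\<^bsub>K\<^esub> (y' \<oplus>\<^bsub>K\<^esub> foldr (\<oplus>\<^bsub>K\<^esub>) zs' \<zero>\<^bsub>K\<^esub>) = \<zero>\<^bsub>K\<^esub>"
    "x' \<otimes>\<^bsub>K\<^esub> (y' \<otimes>\<^bsub>K\<^esub> foldr (\<otimes>\<^bsub>K\<^esub>) zs' \<one>\<^bsub>K\<^esub>) = \<pi> a"
    by (rule K.split_factorisation[OF \<open>n > 2\<close> ext[OF K]])
  define \<sigma> where "\<sigma> = inv_into (carrier A) \<pi>"
  have \<sigma>: "\<sigma> b \<in> carrier A" "\<pi> (\<sigma> b) = b" if "b \<in> carrier K" for b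
    using that surj inv_into_into[of b \<pi> "carrier A"] f_inv_into_f[of b \<pi> "carrier A"]
    by (auto simp: \<sigma>_def)
  define zs where "zs = map \<sigma> zs'"
  have zs: "set zs \<subseteq> carrier A" "map \<pi> zs = zs'" "set zs \<subseteq> Units A"
  proof -
    show "set zs \<subseteq> carrier A" using fac(5) \<sigma> by (auto simp: zs_def)
    show "map \<pi> zs = zs'" using fac(5) \<sigma> by (auto simp: zs_def o_def intro!: map_idI)
    show "set zs \<subseteq> Units A"
    proof
      fix z assume "z \<in> set zs"
      then obtain b where "b \<in> set zs'" "z = \<sigma> b" by (auto simp: zs_def)
      then have "z \<in> carrier A" "\<pi> z \<noteq> \<zero>\<^bsub>K\<^esub>" using fac(5) \<sigma> by auto
      then show "z \<in> Units A" using ker by blast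
    qed
  qed
  have \<pi>sum: "\<pi> (foldr (\<oplus>\<^bsub>A\<^esub>) us \<zero>\<^bsub>A\<^esub>) = foldr (\<oplus>\<^bsub>K\<^esub>) (map \<pi> us) \<zero>\<^bsub>K\<^esub>" if "set us \<subseteq> carrier A" for us
    using that by (induction us) (auto simp: C.foldr_add_closed)
  have \<pi>prod: "\<pi> (foldr (\<otimes>\<^bsub>A\<^esub>) us \<one>\<^bsub>A\<^esub>) = foldr (\<otimes>\<^bsub>K\<^esub>) (map \<pi> us) \<one>\<^bsub>K\<^esub>" if "set us \<subseteq> carrier A" for us
    using that by (induction us) (auto simp: C.foldr_mult_closed)
  define S where "S = foldr (\<oplus>\<^bsub>A\<^esub>) zs \<zero>\<^bsub>A\<^esub>"
  define P where "P = foldr (\<otimes>\<^bsub>A\<^esub>) zs \<one>\<^bsub>A\<^esub>"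
  have SP: "S \<in> carrier A" "P \<in> carrier A" "\<pi> S = foldr (\<oplus>\<^bsub>K\<^esub>) zs' \<zero>\<^bsub>K\<^esub>" "\<pi> P = foldr (\<otimes>\<^bsub>K\<^esub>) zs' \<one>\<^bsub>K\<^esub>"
    using zs(1,2) \<pi>sum \<pi>prod C.foldr_add_closed C.foldr_mult_closed by (auto simp: S_def P_def)
  define y where "y = \<sigma> y'"
  define x where "x = \<ominus>\<^bsub>A\<^esub> (y \<oplus>\<^bsub>A\<^esub> S)"
  have y: "y \<in> carrier A" "\<pi> y = y'" using \<sigma> fac(3) by (auto simp: y_def)
  have x: "x \<in> carrier A" "x \<oplus>\<^bsub>A\<^esub> (y \<oplus>\<^bsub>A\<^esub> S) = \<zero>\<^bsub>A\<^esub>"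
    using y SP by (auto simp: x_def C.l_neg)
  have "\<pi> x = \<ominus>\<^bsub>K\<^esub> (y' \<oplus>\<^bsub>K\<^esub> \<pi> S)" using y SP by (simp add: x_def)
  also have "\<dots> = x'"
  proof (rule K.sum_zero_eq_neg[symmetric, OF fac(2)])
    show "y' \<oplus>\<^bsub>K\<^esub> \<pi> S \<in> carrier K" using fac(3) SP(1) by simp
    show "x' \<oplus>\<^bsub>K\<^esub> (y' \<oplus>\<^bsub>K\<^esub> \<pi> S) = \<zero>\<^bsub>K\<^esub>" using fac(6) SP(3) by simp
  qed
  finally have \<pi>x: "\<pi> x = x'" .
  have \<pi>minus: "\<pi> (u \<ominus>\<^bsub>A\<^esub> v) = \<pi> u \<ominus>\<^bsub>K\<^esub> \<pi> v" if "u \<in> carrier A" "v \<in> carrier A" for u v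
    using that by (simp add: a_minus_def)
  have d: "y \<ominus>\<^bsub>A\<^esub> x \<in> Units A"
    using ker[of "y \<ominus>\<^bsub>A\<^esub> x"] x y \<pi>x \<pi>minus fac(2-4) by auto
  define q where "q = x \<otimes>\<^bsub>A\<^esub> (y \<otimes>\<^bsub>A\<^esub> P) \<ominus>\<^bsub>A\<^esub> a"
  have q: "q \<in> carrier A" using x y SP a by (simp add: q_def)
  have "\<pi> q = \<zero>\<^bsub>K\<^esub>"
    using x y \<pi>x SP a fac(7) by (simp add: q_def \<pi>minus a_minus_def K.r_neg)
  then have "q \<notin> Units A" using ker q by blast
  then obtain k where "q [^]\<^bsub>A\<^esub> ((2::nat) ^ k) = \<zero>\<^bsub>A\<^esub>"
    using unit_or_nilpotent[OF A \<open>cring A\<close> loc q] by blast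
  then have "has_non_power_balanced_factorisation A (length zs + 2) a"
    using C.lift_balanced_factorisation[OF nz a x(1) y(1) zs(3) x(2)[unfolded S_def] d]
    by (simp add: q_def P_def)
  then show ?thesis using fac(1) by (simp add: zs_def)
qed

section \<open>Products of algebras\<close>

context cring
begin

lemma idempotent_corner_iff:
  assumes "e \<in> carrier R" "e \<otimes> e = e"
  shows "x \<in> (\<otimes>) e ` carrier R \<longleftrightarrow> x \<in> carrier R \<and> e \<otimes> x = x"
proof
  assume "x \<in> (\<otimes>) e ` carrier R"
  then show "x \<in> carrier R \<and> e \<otimes> x = x" using assms by (auto simp: m_assoc[symmetric])
next
  assume "x \<in> carrier R \<and> e \<otimes> x = x"
  then show "x \<in> (\<otimes>) e ` carrier R" by (intro image_eqI[of _ _ x]) auto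
qed

end

text \<open>
  Decompositions of \<open>R\<close> as a product of rings are handled inside \<open>R\<close>: if \<open>f\<close> and \<open>g\<close> are orthogonal
  idempotents with sum \<open>e\<close>, then the corner at \<open>e\<close> is the product of the corners at \<open>f\<close> and \<open>g\<close>.
\<close>

abbreviation corner :: "('b, 'm) ring_scheme \<Rightarrow> 'b \<Rightarrow> ('b, 'm) ring_scheme" where
  "corner R e \<equiv> R\<lparr>carrier := (\<otimes>\<^bsub>R\<^esub>) e ` carrier R, one := e\<rparr>"

text \<open>
  Factorisations in the two corners are added entry by entry. Elements of different corners multiply to
  \<open>0\<close>, so the product of the sums is the sum of the products. Multiplying by \<open>f\<close> recovers the entries
  of the first list, so distinct entries stay distinct.
\<close>

lemma (in cring) corner_orthogonal_sum:
  assumes f: "f \<in> carrier R" "f \<otimes> f = f" and g: "g \<in> carrier R" "g \<otimes> g = g"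
    and orth: "f \<otimes> g = \<zero>"
    and a: "a \<in> carrier R" "(f \<oplus> g) \<otimes> a = a"
    and fac_f: "has_non_power_balanced_factorisation (corner R f) n (f \<otimes> a)"
    and fac_g: "has_non_power_balanced_factorisation (corner R g) n (g \<otimes> a)"
  shows "has_non_power_balanced_factorisation (corner R (f \<oplus> g)) n a"
proof -
  obtain xs where xs: "length xs = n" "set xs \<subseteq> (\<otimes>) f ` carrier R"
      "foldr (\<otimes>) xs f = f \<otimes> a" "foldr (\<oplus>) xs \<zero> = \<zero>" "non_power xs"
    using fac_f by (auto simp: has_non_power_balanced_factorisation_def balanced_factorisation_def)
  obtain ys where ys: "length ys = n" "set ys \<subseteq> (\<otimes>) g ` carrier R"
      "foldr (\<otimes>) ys g = g \<otimes> a" "foldr (\<oplus>) ys \<zero> = \<zero>"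
    using fac_g by (auto simp: has_non_power_balanced_factorisation_def balanced_factorisation_def)
  have fx: "x \<in> carrier R" "f \<otimes> x = x" "g \<otimes> x = \<zero>" if "x \<in> (\<otimes>) f ` carrier R" for x
  proof -
    show x: "x \<in> carrier R" "f \<otimes> x = x" using that idempotent_corner_iff[OF f] by auto
    have "g \<otimes> (f \<otimes> x) = (f \<otimes> g) \<otimes> x" using f(1) g(1) x(1) by algebra
    then show "g \<otimes> x = \<zero>" using x orth by simp
  qed
  have gy: "y \<in> carrier R" "g \<otimes> y = y" "f \<otimes> y = \<zero>" if "y \<in> (\<otimes>) g ` carrier R" for y
  proof -
    show y: "y \<in> carrier R" "g \<otimes> y = y" using that idempotent_corner_iff[OF g] by auto
    have "f \<otimes> (g \<otimes> y) = (f \<otimes> g) \<otimes> y" using f(1) g(1) y(1) by algebra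
    then show "f \<otimes> y = \<zero>" using y orth by simp
  qed
  have fg0: "x \<otimes> y = \<zero>" if "x \<in> carrier R" "f \<otimes> x = x" "y \<in> carrier R" "f \<otimes> y = \<zero>" for x y
  proof -
    have "(f \<otimes> x) \<otimes> y = x \<otimes> (f \<otimes> y)" using that(1,3) f(1) by algebra
    then show ?thesis using that by simp
  qed
  define zs where "zs = map2 (\<oplus>) xs ys"
  have len: "length zs = n" using xs(1) ys(1) by (simp add: zs_def)
  have folds: "foldr (\<otimes>) (map2 (\<oplus>) us vs) (f \<oplus> g) = foldr (\<otimes>) us f \<oplus> foldr (\<otimes>) vs g \<and>
      foldr (\<oplus>) (map2 (\<oplus>) us vs) \<zero> = foldr (\<oplus>) us \<zero> \<oplus> foldr (\<oplus>) vs \<zero> \<and>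
      foldr (\<otimes>) us f \<in> carrier R \<and> f \<otimes> foldr (\<otimes>) us f = foldr (\<otimes>) us f \<and>
      foldr (\<otimes>) vs g \<in> carrier R \<and> f \<otimes> foldr (\<otimes>) vs g = \<zero> \<and>
      foldr (\<oplus>) us \<zero> \<in> carrier R \<and> foldr (\<oplus>) vs \<zero> \<in> carrier R"
    if "length us = length vs" "set us \<subseteq> (\<otimes>) f ` carrier R" "set vs \<subseteq> (\<otimes>) g ` carrier R" for us vs
    using that
  proof (induction us vs rule: list_induct2)
    case Nil
    then show ?case using f g orth by simp
  next
    case (Cons x us y vs)
    define P where "P = foldr (\<otimes>) us f"
    define Q where "Q = foldr (\<otimes>) vs g"
    define S where "S = foldr (\<oplus>) us \<zero>"
    define T where "T = foldr (\<oplus>) vs \<zero>"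
    have IH: "foldr (\<otimes>) (map2 (\<oplus>) us vs) (f \<oplus> g) = P \<oplus> Q"
        "foldr (\<oplus>) (map2 (\<oplus>) us vs) \<zero> = S \<oplus> T"
        "P \<in> carrier R" "f \<otimes> P = P" "Q \<in> carrier R" "f \<otimes> Q = \<zero>" "S \<in> carrier R" "T \<in> carrier R"
      using Cons by (simp_all add: P_def Q_def S_def T_def)
    have "x \<in> (\<otimes>) f ` carrier R" "y \<in> (\<otimes>) g ` carrier R" using Cons.prems by auto
    note x = fx[OF this(1)] and y = gy[OF this(2)]
    have "x \<otimes> Q = \<zero>" "P \<otimes> y = \<zero>" using fg0 x y IH by auto
    moreover have "(x \<oplus> y) \<otimes> (P \<oplus> Q) = (x \<otimes> P \<oplus> y \<otimes> Q) \<oplus> (x \<otimes> Q \<oplus> P \<otimes> y)"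
      using x(1) y(1) IH(3,5) by algebra
    ultimately have "(x \<oplus> y) \<otimes> (P \<oplus> Q) = x \<otimes> P \<oplus> y \<otimes> Q" using x(1) y(1) IH by simp
    moreover have "(x \<oplus> y) \<oplus> (S \<oplus> T) = (x \<oplus> S) \<oplus> (y \<oplus> T)" using x(1) y(1) IH(7,8) by algebra
    moreover have "f \<otimes> (x \<otimes> P) = x \<otimes> P" "f \<otimes> (y \<otimes> Q) = \<zero>"
      using x y IH f(1) by (simp_all add: m_assoc[symmetric])
    ultimately show ?case
      using x(1) y(1) IH by (simp flip: P_def Q_def S_def T_def)
  qed
  note zs = folds[of xs ys, folded zs_def]
  have corner: "z \<in> (\<otimes>) (f \<oplus> g) ` carrier R" if "z \<in> set zs" for z
  proof -
    from that obtain x y where xy: "x \<in> set xs" "y \<in> set ys" "z = x \<oplus> y"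
      unfolding zs_def by (auto dest: set_zip_leftD set_zip_rightD)
    then have "x \<in> (\<otimes>) f ` carrier R" "y \<in> (\<otimes>) g ` carrier R" using xs ys by auto
    note x = fx[OF this(1)] and y = gy[OF this(2)]
    have "(f \<oplus> g) \<otimes> (x \<oplus> y) = (f \<otimes> x \<oplus> g \<otimes> x) \<oplus> (f \<otimes> y \<oplus> g \<otimes> y)"
      using f(1) g(1) x(1) y(1) by algebra
    then have "z = (f \<oplus> g) \<otimes> z" using x y xy(3) by simp
    then show ?thesis using x(1) y(1) xy(3) by (intro image_eqI[of _ _ z]) auto
  qed
  have "foldr (\<otimes>) zs (f \<oplus> g) = a"
    using zs xs ys a f(1) g(1) by (simp add: l_distr)
  moreover have "foldr (\<oplus>) zs \<zero> = \<zero>" using zs xs ys by simp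
  moreover have "non_power zs"
  proof -
    obtain i j where ij: "i < n" "j < n" "xs ! i \<noteq> xs ! j"
      using xs(1,5) by (auto simp: non_power_def in_set_conv_nth)
    have fz: "f \<otimes> (zs ! k) = xs ! k" if "k < n" for k
    proof -
      have "xs ! k \<in> (\<otimes>) f ` carrier R" "ys ! k \<in> (\<otimes>) g ` carrier R"
        using that xs ys nth_mem by (metis subsetD)+
      note x = fx[OF this(1)] and y = gy[OF this(2)]
      show ?thesis using that xs(1) ys(1) x y f(1) by (simp add: zs_def r_distr)
    qed
    have "zs ! i \<noteq> zs ! j" using fz[OF ij(1)] fz[OF ij(2)] ij(3) by metis
    moreover have "zs ! i \<in> set zs" "zs ! j \<in> set zs" using ij len by simp_all
    ultimately show ?thesis unfolding non_power_def by blast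
  qed
  ultimately show ?thesis
    unfolding has_non_power_balanced_factorisation_def balanced_factorisation_def
    using corner len by (intro exI[of _ zs]) auto
qed

lemma fin_dim_algebra_corner:
  assumes A: "fin_dim_algebra F A" and "cring A" and e: "e \<in> carrier A" "e \<otimes>\<^bsub>A\<^esub> e = e"
  shows "fin_dim_algebra F (corner A e)" "cring (corner A e)"
proof -
  interpret C: cring A by fact
  interpret alg: unital_assoc_algebra F A using A by (simp add: fin_dim_algebra_def)
  note mem = C.idempotent_corner_iff[OF e]
  show fd: "fin_dim_algebra F (corner A e)"
  proof (rule fin_dim_subalgebra[OF A alg.principal_submodule[OF e(1)]])
    fix x assume "x \<in> (\<otimes>\<^bsub>A\<^esub>) e ` carrier A"
    then have x: "x \<in> carrier A" "e \<otimes>\<^bsub>A\<^esub> x = x" using mem by auto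
    then show "e \<otimes>\<^bsub>A\<^esub> x = x" "x \<otimes>\<^bsub>A\<^esub> e = x" using C.m_comm e by auto
    show "x \<otimes>\<^bsub>A\<^esub> y \<in> (\<otimes>\<^bsub>A\<^esub>) e ` carrier A" if "y \<in> (\<otimes>\<^bsub>A\<^esub>) e ` carrier A" for y
      using that x e mem by (simp add: C.m_assoc[symmetric])
  qed (use e mem in simp)
  interpret E: ring "corner A e"
    using fd by (simp add: fin_dim_algebra_def unital_assoc_algebra_def)
  show "cring (corner A e)"
    by (intro cring.intro E.ring_axioms E.monoid_comm_monoidI) (use mem C.m_comm in auto)
qed

text \<open>
  An idempotent is called good if every element of its corner has a factorisation there. Among the
  corners of nonzero idempotents that are not good, a minimal one, at \<open>e\<close>, cannot be local, so \<open>e\<close> is a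
  sum of two nonzero orthogonal idempotents. Their corners are smaller, hence good, and
  so \<open>e\<close> is good after all.
\<close>

lemma commutative_algebra_factorisation:
  fixes F :: "('a, 'm) ring_scheme" and A :: "('a, 'b, 'n) module_scheme"
  assumes A: "fin_dim_algebra F A" and "cring A" and nz: "\<one>\<^bsub>A\<^esub> \<noteq> \<zero>\<^bsub>A\<^esub>"
    and "n > 2"
    and ext: "\<And>K :: ('a, 'a list) module. finite_field_ext F K \<Longrightarrow>
           \<forall>x \<in> carrier K. has_non_power_balanced_factorisation K n x"
    and a: "a \<in> carrier A"
  shows "has_non_power_balanced_factorisation A n a"
proof -
  interpret C: cring A by fact
  interpret alg: unital_assoc_algebra F A using A by (simp add: fin_dim_algebra_def)
  define idem where "idem e \<longleftrightarrow> e \<in> carrier A \<and> e \<otimes>\<^bsub>A\<^esub> e = e \<and> e \<noteq> \<zero>\<^bsub>A\<^esub>" for e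
  define good where
    "good e \<longleftrightarrow> (\<forall>x \<in> (\<otimes>\<^bsub>A\<^esub>) e ` carrier A. has_non_power_balanced_factorisation (corner A e) n x)"
    for e
  have all_good: "good e" if "idem e" for e
  proof (rule ccontr)
    define \<W> where "\<W> = {(\<otimes>\<^bsub>A\<^esub>) e ` carrier A | e. idem e \<and> \<not> good e}"
    assume "\<not> good e"
    with that have "\<W> \<noteq> {}" by (auto simp: \<W>_def)
    moreover have "submodule W F A" if "W \<in> \<W>" for W
      using that alg.principal_submodule by (auto simp: \<W>_def idem_def)
    moreover have "finitely_spanned F A" using A by (simp add: fin_dim_algebra_def)
    ultimately obtain W where W: "W \<in> \<W>" and min: "\<And>V. \<lbrakk>V \<in> \<W>; V \<subseteq> W\<rbrakk> \<Longrightarrow> V = W"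
      using submodule_family_has_minimal[OF alg.F.field_axioms alg.module_axioms, of \<W>] by metis
    then obtain e where e: "idem e" "\<not> good e" "W = (\<otimes>\<^bsub>A\<^esub>) e ` carrier A"
      by (auto simp: \<W>_def)
    have ec: "e \<in> carrier A" "e \<otimes>\<^bsub>A\<^esub> e = e" "e \<noteq> \<zero>\<^bsub>A\<^esub>" using e(1) by (auto simp: idem_def)
    note mem = C.idempotent_corner_iff[OF ec(1,2)]
    have "\<exists>f. f \<in> carrier A \<and> e \<otimes>\<^bsub>A\<^esub> f = f \<and> f \<otimes>\<^bsub>A\<^esub> f = f \<and> f \<noteq> \<zero>\<^bsub>A\<^esub> \<and> f \<noteq> e"
    proof (rule ccontr)
      assume *: "\<nexists>f. f \<in> carrier A \<and> e \<otimes>\<^bsub>A\<^esub> f = f \<and> f \<otimes>\<^bsub>A\<^esub> f = f \<and> f \<noteq> \<zero>\<^bsub>A\<^esub> \<and> f \<noteq> e"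
      have "good e"
        unfolding good_def
      proof
        fix x assume x: "x \<in> (\<otimes>\<^bsub>A\<^esub>) e ` carrier A"
        show "has_non_power_balanced_factorisation (corner A e) n x"
        proof (rule local_algebra_factorisation[OF
              fin_dim_algebra_corner[OF A \<open>cring A\<close> ec(1,2)] _ _ \<open>n > 2\<close> ext])
          show "f = \<zero>\<^bsub>corner A e\<^esub> \<or> f = \<one>\<^bsub>corner A e\<^esub>"
            if "f \<in> carrier (corner A e)" "f \<otimes>\<^bsub>corner A e\<^esub> f = f" for f
            using * that mem by auto
        qed (use x ec in auto)
      qed
      with e(2) show False by simp
    qed
    then obtain f where f: "f \<in> carrier A" "e \<otimes>\<^bsub>A\<^esub> f = f" "f \<otimes>\<^bsub>A\<^esub> f = f" "f \<noteq> \<zero>\<^bsub>A\<^esub>" "f \<noteq> e"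
      by blast
    define g where "g = e \<ominus>\<^bsub>A\<^esub> f"
    have g: "g \<in> carrier A" "f \<oplus>\<^bsub>A\<^esub> g = e" "e \<otimes>\<^bsub>A\<^esub> g = g" "g \<otimes>\<^bsub>A\<^esub> g = g" "f \<otimes>\<^bsub>A\<^esub> g = \<zero>\<^bsub>A\<^esub>"
        "g \<noteq> \<zero>\<^bsub>A\<^esub>" "g \<noteq> e"
    proof -
      show gc: "g \<in> carrier A" using f ec by (simp add: g_def)
      show fg: "f \<oplus>\<^bsub>A\<^esub> g = e" unfolding g_def using f(1) ec(1) by algebra
      have "e \<otimes>\<^bsub>A\<^esub> g = e \<otimes>\<^bsub>A\<^esub> e \<ominus>\<^bsub>A\<^esub> e \<otimes>\<^bsub>A\<^esub> f" unfolding g_def using f(1) ec(1) by algebra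
      then show eg: "e \<otimes>\<^bsub>A\<^esub> g = g" using ec f by (simp add: g_def)
      have "f \<otimes>\<^bsub>A\<^esub> g = e \<otimes>\<^bsub>A\<^esub> f \<ominus>\<^bsub>A\<^esub> f \<otimes>\<^bsub>A\<^esub> f" unfolding g_def using f(1) ec(1) by algebra
      then show 0: "f \<otimes>\<^bsub>A\<^esub> g = \<zero>\<^bsub>A\<^esub>" using f by simp
      have "g \<otimes>\<^bsub>A\<^esub> g = e \<otimes>\<^bsub>A\<^esub> g \<ominus>\<^bsub>A\<^esub> f \<otimes>\<^bsub>A\<^esub> g"
        unfolding fg[symmetric] using f(1) gc by algebra
      then show "g \<otimes>\<^bsub>A\<^esub> g = g" using 0 eg gc by (simp add: C.minus_eq)
      show "g \<noteq> \<zero>\<^bsub>A\<^esub>" using fg f by auto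
      show "g \<noteq> e" using 0 f ec C.m_comm[of f e] by auto
    qed
    have smaller: "good h" if h: "h \<in> carrier A" "e \<otimes>\<^bsub>A\<^esub> h = h" "h \<otimes>\<^bsub>A\<^esub> h = h" "h \<noteq> \<zero>\<^bsub>A\<^esub>" "h \<noteq> e" for h
    proof (rule ccontr)
      assume "\<not> good h"
      then have "(\<otimes>\<^bsub>A\<^esub>) h ` carrier A \<in> \<W>" using h by (auto simp: \<W>_def idem_def)
      moreover have "(\<otimes>\<^bsub>A\<^esub>) h ` carrier A \<subseteq> W"
      proof
        fix x assume "x \<in> (\<otimes>\<^bsub>A\<^esub>) h ` carrier A"
        then obtain x' where "x' \<in> carrier A" "x = h \<otimes>\<^bsub>A\<^esub> x'" by blast
        then show "x \<in> W" unfolding e(3) mem using h ec by (simp add: C.m_assoc[symmetric])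
      qed
      ultimately have "(\<otimes>\<^bsub>A\<^esub>) h ` carrier A = W" by (rule min)
      moreover have "e \<in> W" unfolding e(3) mem using ec by simp
      ultimately have "h \<otimes>\<^bsub>A\<^esub> e = e" using C.idempotent_corner_iff[OF h(1,3)] by auto
      then show False using h ec C.m_comm[of h e] by auto
    qed
    have "good e"
      unfolding good_def
    proof
      fix x assume "x \<in> (\<otimes>\<^bsub>A\<^esub>) e ` carrier A"
      then have x: "x \<in> carrier A" "e \<otimes>\<^bsub>A\<^esub> x = x" using mem by auto
      have "has_non_power_balanced_factorisation (corner A f) n (f \<otimes>\<^bsub>A\<^esub> x)"
        using smaller[OF f] x by (auto simp: good_def)
      moreover have "has_non_power_balanced_factorisation (corner A g) n (g \<otimes>\<^bsub>A\<^esub> x)"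
        using smaller[OF g(1,3,4,6,7)] x by (auto simp: good_def)
      ultimately show "has_non_power_balanced_factorisation (corner A e) n x"
        using C.corner_orthogonal_sum[OF f(1,3) g(1,4,5), of x n] x g(2) by simp
    qed
    with e(2) show False by simp
  qed
  have "idem \<one>\<^bsub>A\<^esub>" using nz by (simp add: idem_def)
  then have "good \<one>\<^bsub>A\<^esub>" by (rule all_good)
  moreover have "(\<otimes>\<^bsub>A\<^esub>) \<one>\<^bsub>A\<^esub> ` carrier A = carrier A"
    using C.idempotent_corner_iff[of "\<one>\<^bsub>A\<^esub>"] by auto
  ultimately have "has_non_power_balanced_factorisation (A\<lparr>carrier := carrier A, one := \<one>\<^bsub>A\<^esub>\<rparr>) n a"
    using a by (simp add: good_def)
  then show ?thesis by simp
qed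

theorem theorem4:
  fixes F :: "('a, 'm) ring_scheme"
    and A :: "('a, 'b, 'n) module_scheme"
    and n :: nat
  assumes "field F" and "n > 2"
    and "\<And>K :: ('a, 'a list) module. finite_field_ext F K \<Longrightarrow>
           \<forall>x \<in> carrier K. has_non_power_balanced_factorisation K n x"
    and "fin_dim_algebra F A" and "carrier A \<noteq> {\<zero>\<^bsub>A\<^esub>}"
  shows "\<forall>a \<in> carrier A. has_non_power_balanced_factorisation A n a"
proof
  fix a assume a: "a \<in> carrier A"
  interpret alg: unital_assoc_algebra F A using assms(4) by (simp add: fin_dim_algebra_def)
  obtain D where D: "a \<in> D" "D \<subseteq> carrier A" "\<one>\<^bsub>A\<^esub> \<in> D"
    "fin_dim_algebra F (A\<lparr>carrier := D, one := \<one>\<^bsub>A\<^esub>\<rparr>)" "cring (A\<lparr>carrier := D, one := \<one>\<^bsub>A\<^esub>\<rparr>)"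
    using commutative_subalgebra_containing[OF assms(4) a] by blast
  have nz: "\<one>\<^bsub>A\<^esub> \<noteq> \<zero>\<^bsub>A\<^esub>" using assms(5) alg.A.one_zeroD by blast
  have "has_non_power_balanced_factorisation (A\<lparr>carrier := D, one := \<one>\<^bsub>A\<^esub>\<rparr>) n a"
    by (rule commutative_algebra_factorisation[OF D(4,5) _ assms(2,3)]) (use nz D(1) in auto)
  then show "has_non_power_balanced_factorisation A n a"
    using D(2) by (auto simp: has_non_power_balanced_factorisation_def balanced_factorisation_def)
qed

end
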